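(* Let $(\mathcal D_n)_{n\ge1}$ be a sequence of feasible degree sequences, let $V=[n]$, and let $d=d(n)$. (a) If $|S_n(d)|\to\infty$, then for any $p=p(n)\in[0,1]$, $$\mathbb P\left[L_1(\mathbf G(\mathcal D_n)_p)\le(1+o(1))\left(|S_n(d)|+\sum_{v\notin S_n(d)}\left(1-(1-p)^{d(v)}\right)\right)\right]=1-o(1).$$ (b) If $d(S_n(d))\gg d(V\setminus S_n(d))$, then for any $p=p(n)\in[0,1]$ with $p\gg1/d$, a.a.s. there is a connected component in $\mathbf G(\mathcal D_n)_p$ containing a $(1-o(1))$-proportion of the edges of $\mathbf G(\mathcal D_n)_p$.
   Context: For each $n$, $\mathcal D_n$ is a sequence of $n$ integers, each $\ge1$, that is feasible, i.e. there is a simple graph on $[n]$ with this degree sequence; $d(v)$ denotes the prescribed degree of vertex $v\in[n]$ (its $v$-th entry). $\mathbf G(\mathcal D_n)$ is a uniformly random simple graph on $[n]$ among those in which each $v$ has degree $d(v)$. For a graph $G$ and $p\in[0,1]$, $G_p$ is the random subgraph on the same vertex set in which each edge of $G$ is kept independently with probability $p$. $L_1(G)$ is the number of vertices of a largest component of $G$. $S_n(x)=\{v\in[n]:d(v)\ge x\}$, and for a vertex set $S$, $d(S)=\sum_{v\in S}d(v)$. Asymptotics are as $n\to\infty$; $f\gg g$ means that for every $\varepsilon>0$, $g(n)\le\varepsilon f(n)$ for all large $n$; a.a.s. means with probability tending to $1$. *)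

theory Defs
  imports "HOL-Probability.Probability"
begin

text \<open>A simple graph on the vertex set \<open>{1..n}\<close> is identified with its set of edges,
  each edge being a two-element set of vertices.\<close>

definition simple_graph :: "nat \<Rightarrow> nat set set \<Rightarrow> bool" where
  "simple_graph n E \<longleftrightarrow> (\<forall>e\<in>E. e \<subseteq> {1..n} \<and> card e = 2)"

definition vertex_degree :: "nat set set \<Rightarrow> nat \<Rightarrow> nat" where
  "vertex_degree E v = card {e \<in> E. v \<in> e}"

text \<open>A degree sequence of length \<open>n\<close> is a function \<open>D\<close> whose \<open>v\<close>-th entry is \<open>D v\<close>;
  only its values on \<open>{1..n}\<close> matter.\<close>

definition realizations :: "nat \<Rightarrow> (nat \<Rightarrow> nat) \<Rightarrow> nat set set set" where
  "realizations n D = {E. simple_graph n E \<and> (\<forall>v\<in>{1..n}. vertex_degree E v = D v)}"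

text \<open>All degrees are at least one, so no sequence of length \<open>1\<close> is feasible; hypotheses of
  feasibility for all \<open>n\<close> have to start at \<open>n = 2\<close>.\<close>

definition feasible :: "nat \<Rightarrow> (nat \<Rightarrow> nat) \<Rightarrow> bool" where
  "feasible n D \<longleftrightarrow> (\<forall>v\<in>{1..n}. 1 \<le> D v) \<and> (\<exists>E. E \<in> realizations n D)"

definition random_graph :: "nat \<Rightarrow> (nat \<Rightarrow> nat) \<Rightarrow> nat set set pmf" where
  "random_graph n D = pmf_of_set (realizations n D)"

definition percolate :: "real \<Rightarrow> nat set set \<Rightarrow> nat set set pmf" where
  "percolate p E =
     map_pmf (\<lambda>kept. {e \<in> E. kept e}) (Pi_pmf E False (\<lambda>_. bernoulli_pmf p))"

definition percolated_random_graph ::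
    "nat \<Rightarrow> (nat \<Rightarrow> nat) \<Rightarrow> real \<Rightarrow> nat set set pmf" where
  "percolated_random_graph n D p = bind_pmf (random_graph n D) (percolate p)"

definition component_of :: "nat \<Rightarrow> nat set set \<Rightarrow> nat \<Rightarrow> nat set" where
  "component_of n E v = {u \<in> {1..n}. (v, u) \<in> {(x, y). {x, y} \<in> E}\<^sup>*}"

text \<open>Components are represented by their vertex sets; isolated vertices are components.\<close>

definition graph_components :: "nat \<Rightarrow> nat set set \<Rightarrow> nat set set" where
  "graph_components n E = component_of n E ` {1..n}"

definition L1 :: "nat \<Rightarrow> nat set set \<Rightarrow> nat" where
  "L1 n E = Max (card ` graph_components n E)"

definition edges_inside :: "nat set set \<Rightarrow> nat set \<Rightarrow> nat set set" where
  "edges_inside E C = {e \<in> E. e \<subseteq> C}"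

definition high_degree :: "nat \<Rightarrow> (nat \<Rightarrow> nat) \<Rightarrow> real \<Rightarrow> nat set" where
  "high_degree n D x = {v \<in> {1..n}. x \<le> real (D v)}"

definition degree_sum :: "(nat \<Rightarrow> nat) \<Rightarrow> nat set \<Rightarrow> nat" where
  "degree_sum D S = (\<Sum>v\<in>S. D v)"

text \<open>Without absolute values, so only meaningful for eventually nonnegative functions.\<close>

definition much_greater :: "(nat \<Rightarrow> real) \<Rightarrow> (nat \<Rightarrow> real) \<Rightarrow> bool"  (infix "\<ggreater>" 50) where
  "f \<ggreater> g \<longleftrightarrow> (\<forall>\<epsilon>>0. \<forall>\<^sub>F n in sequentially. g n \<le> \<epsilon> * f n)"

end

theory Submission
  imports Defs
begin

text \<open>
  Write \<open>G\<close> for the uniform random graph, \<open>H\<close> for the percolated graph, \<open>S\<close> for the set of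
  vertices of degree at least \<open>d\<close>, and \<open>M\<close> for the sum of all degrees.

  \<^bold>\<open>Part (a).\<close> A component is a single vertex or consists of vertices that are not isolated in \<open>H\<close>.
  Hence \<open>L1\<close> is at most \<open>|S| + N\<close> once \<open>S\<close> is nonempty, where \<open>N\<close> counts the non-isolated vertices outside \<open>S\<close>.
  For every fixed \<open>G\<close> the mean of \<open>N\<close> is the sum \<open>\<mu>\<close> in the statement. Two vertices interact only
  through an edge joining them, and this makes the variance of \<open>N\<close> at most \<open>2\<mu>\<close>
  (\<open>touched_variance_le\<close>). Chebyshev's inequality with relative error \<open>|S|\<close> to the power \<open>-1/4\<close>
  concludes.

  \<^bold>\<open>Part (b).\<close> Call a quadruple \<open>a b c d\<close> separated if \<open>ab\<close> and \<open>cd\<close> are edges of \<open>H\<close> in different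
  components. If the number \<open>Q\<close> of separated quadruples is small compared with the squared number of
  edges of \<open>H\<close>, then one component holds almost all edges
  (\<open>giant_component_if_few_separated\<close>). As \<open>H\<close> has about \<open>pM/2\<close> edges, it suffices that the mean
  of \<open>Q\<close> is of smaller order than \<open>(pM)\<close> squared. Quadruples that meet the complement of \<open>S\<close> are
  rare because few edges do. For quadruples inside \<open>S\<close> the mean is of order \<open>p |S| M\<close>
  (\<open>separated_mean_le\<close>), which is of order at most \<open>p M M / d\<close> because \<open>d |S| \<le> M\<close>; this is where \<open>p\<close> being
  much larger than \<open>1/d\<close> enters. The bound inside \<open>S\<close> rests on the fact that \<open>H\<close> has at most
  \<open>|S|\<close> bridges inside \<open>S\<close> (\<open>bridge_count\<close>), which is used in two ways.

  \<^item> If \<open>ac\<close> and \<open>bd\<close> are not edges of \<open>G\<close>, replace \<open>ab\<close> and \<open>cd\<close> by \<open>ac\<close> and \<open>bd\<close>, both in \<open>G\<close>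
    and in \<open>H\<close>. This preserves all degrees and the probability weight, it is invertible, and
    afterwards \<open>bd\<close> is a bridge of \<open>H\<close> without \<open>ac\<close>. So the switched quadruples are few, and so are
    the original ones (\<open>sum_switchable_le\<close>).

  \<^item> If neither this switching nor the one with \<open>c\<close> and \<open>d\<close> exchanged is available, then one of the
    four vertices, the apex, is adjacent in \<open>G\<close> to both ends of the opposite edge. This case cannot
    be discarded: the degree sequence may determine \<open>G\<close>, so that no switching exists at all. Here
    the randomness of the percolation alone suffices. For a fixed apex \<open>a\<close> with neighbourhood \<open>T\<close>
    inside \<open>S\<close>, percolate first the edges that avoid \<open>a\<close>. An edge \<open>xy\<close> inside \<open>T\<close> stays separated
    from \<open>a\<close> only if \<open>a\<close> loses all its edges to the component of \<open>x\<close>, which has probability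
    \<open>(1 - p) ^ k\<close> if this component has \<open>k\<close> vertices in \<open>T\<close>. The weighted number of such edges
    \<open>xy\<close> has mean at most \<open>3 |T|\<close> (\<open>class_weighted_edges_le\<close>): apart from bridges, an edge is kept
    with probability \<open>p\<close> independently of whether the remaining edges connect its ends, each
    vertex \<open>x\<close> is connected to only \<open>k\<close> vertices of \<open>T\<close>, and \<open>p k (1 - p) ^ k \<le> 1\<close>.
\<close>

section \<open>Means over percolated graphs\<close>

text \<open>The mean of \<open>f\<close> over the random subset of \<open>G\<close> that keeps every element independently with
  probability \<open>p\<close>. Written as a finite sum over subsets, so that the percolations of two
  different graphs can be compared term by term.\<close>

definition perc_mean :: "real \<Rightarrow> 'a set \<Rightarrow> ('a set \<Rightarrow> real) \<Rightarrow> real" where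
  "perc_mean p G f = (\<Sum>H\<in>Pow G. p ^ card H * (1 - p) ^ card (G - H) * f H)"

lemma perc_mean_empty [simp]: "perc_mean p {} f = f {}"
  by (simp add: perc_mean_def)

lemma perc_mean_cong:
  assumes "\<And>H. H \<subseteq> G \<Longrightarrow> f H = g H"
  shows "perc_mean p G f = perc_mean p G g"
  unfolding perc_mean_def using assms by (auto intro!: sum.cong)

lemma perc_mean_mono:
  assumes "0 \<le> p" "p \<le> 1" "\<And>H. H \<subseteq> G \<Longrightarrow> f H \<le> g H"
  shows "perc_mean p G f \<le> perc_mean p G g"
  unfolding perc_mean_def using assms by (auto intro!: sum_mono mult_left_mono)

lemma perc_mean_add: "perc_mean p G (\<lambda>H. f H + g H) = perc_mean p G f + perc_mean p G g"
  by (simp add: perc_mean_def sum.distrib algebra_simps)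

lemma perc_mean_cmult: "perc_mean p G (\<lambda>H. c * f H) = c * perc_mean p G f"
  by (simp add: perc_mean_def sum_distrib_left algebra_simps)

lemma perc_mean_cmult_right: "perc_mean p G (\<lambda>H. f H * c) = perc_mean p G f * c"
  by (simp add: perc_mean_def sum_distrib_left sum_distrib_right algebra_simps)

lemma perc_mean_minus: "perc_mean p G (\<lambda>H. f H - g H) = perc_mean p G f - perc_mean p G g"
  by (simp add: perc_mean_def sum_subtractf algebra_simps)

lemma perc_mean_sum: "perc_mean p G (\<lambda>H. \<Sum>i\<in>I. f i H) = (\<Sum>i\<in>I. perc_mean p G (f i))"
  unfolding perc_mean_def sum_distrib_left by (rule sum.swap)

text \<open>Conditioning on a single edge. The independence facts below all come from this rule.\<close>

lemma perc_mean_insert: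
  assumes "finite G" "e \<notin> G"
  shows "perc_mean p (insert e G) f =
    p * perc_mean p G (\<lambda>H. f (insert e H)) + (1 - p) * perc_mean p G f"
proof -
  let ?w = "\<lambda>H. p ^ card H * (1 - p) ^ card (insert e G - H) * f H"
  have inj: "inj_on (insert e) (Pow G)"
    using assms(2) by (auto simp: inj_on_def)
  have "perc_mean p (insert e G) f = sum ?w (Pow G) + sum ?w (insert e ` Pow G)"
    unfolding perc_mean_def Pow_insert using assms
    by (intro sum.union_disjoint) auto
  also have "sum ?w (Pow G) = (1 - p) * perc_mean p G f"
    unfolding perc_mean_def sum_distrib_left
  proof (intro sum.cong refl)
    fix H assume "H \<in> Pow G"
    then have "insert e G - H = insert e (G - H)" "e \<notin> G - H" "finite (G - H)"
      using assms by auto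
    then show "?w H = (1 - p) * (p ^ card H * (1 - p) ^ card (G - H) * f H)" by simp
  qed
  also have "sum ?w (insert e ` Pow G) = p * perc_mean p G (\<lambda>H. f (insert e H))"
    unfolding perc_mean_def sum_distrib_left sum.reindex[OF inj] o_def
  proof (intro sum.cong refl)
    fix H assume H: "H \<in> Pow G"
    have "insert e G - insert e H = G - H" using assms(2) by auto
    moreover have "card (insert e H) = Suc (card H)"
      using H assms by (auto intro: card_insert_disjoint finite_subset)
    ultimately show "?w (insert e H) = p * (p ^ card H * (1 - p) ^ card (G - H) * f (insert e H))"
      by simp
  qed
  finally show ?thesis by simp
qed

lemma perc_mean_const: "finite G \<Longrightarrow> perc_mean p G (\<lambda>_. c) = c"
  by (induction G rule: finite_induct) (auto simp: perc_mean_insert algebra_simps)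

lemma perc_mean_split:
  assumes "finite G" "e \<in> G"
  shows "perc_mean p G f =
    p * perc_mean p (G - {e}) (\<lambda>H. f (insert e H)) + (1 - p) * perc_mean p (G - {e}) f"
  using perc_mean_insert[of "G - {e}" e p f] assms by (simp add: insert_absorb)

lemma perc_mean_kept:
  assumes "finite G" "e \<in> G"
  shows "perc_mean p G (\<lambda>H. of_bool (e \<in> H) * f H) = p * perc_mean p (G - {e}) (\<lambda>H. f (insert e H))"
proof -
  have "perc_mean p (G - {e}) (\<lambda>H. of_bool (e \<in> H) * f H) = perc_mean p (G - {e}) (\<lambda>_. 0)"
    by (rule perc_mean_cong) auto
  then show ?thesis
    using perc_mean_split[OF assms, of p "\<lambda>H. of_bool (e \<in> H) * f H"] assms by (simp add: perc_mean_const)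
qed

lemma perc_mean_edge:
  assumes "finite G" "e \<in> G"
  shows "perc_mean p G (\<lambda>H. of_bool (e \<in> H)) = p"
  using perc_mean_kept[OF assms, of p "\<lambda>_. 1"] assms by (simp add: perc_mean_const)

lemma perc_mean_two_edges:
  assumes "finite G" "e \<in> G" "f \<in> G" "e \<noteq> f"
  shows "perc_mean p G (\<lambda>H. of_bool (e \<in> H) * of_bool (f \<in> H)) = p\<^sup>2"
  using assms perc_mean_edge[of "G - {e}" f p]
  by (simp add: perc_mean_kept power2_eq_square)

lemma perc_mean_avoid:
  assumes "finite G" "A \<subseteq> G"
  shows "perc_mean p G (\<lambda>H. of_bool (H \<inter> A = {})) = (1 - p) ^ card A"
  using assms
proof (induction G arbitrary: A rule: finite_induct)
  case (insert e G)
  have eq: "perc_mean p G (\<lambda>H. of_bool (H \<inter> A = {})) = (1 - p) ^ card (A - {e})"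
  proof -
    have "perc_mean p G (\<lambda>H. of_bool (H \<inter> A = {})) = perc_mean p G (\<lambda>H. of_bool (H \<inter> (A - {e}) = {}))"
      using insert by (intro perc_mean_cong) auto
    then show ?thesis using insert by (subst (asm) insert.IH) auto
  qed
  show ?case
  proof (cases "e \<in> A")
    case True
    have "card A = Suc (card (A - {e}))"
      using True insert by (meson card.remove finite.insertI finite_subset)
    then have "(1 - p) ^ card A = (1 - p) * (1 - p) ^ card (A - {e})"
      by (metis power_Suc)
    then show ?thesis using True insert eq by (simp add: perc_mean_insert perc_mean_const)
  next
    case False
    then have "A - {e} = A" by auto
    with False insert eq show ?thesis by (simp add: perc_mean_insert algebra_simps)
  qed
qed simp

text \<open>Disjoint edge sets are percolated independently, so one of them may be exposed first.\<close>

lemma perc_mean_Un: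
  assumes "finite A" "finite B" "A \<inter> B = {}"
  shows "perc_mean p (A \<union> B) f = perc_mean p A (\<lambda>H. perc_mean p B (\<lambda>K. f (H \<union> K)))"
  using assms(2,3)
proof (induction B arbitrary: f rule: finite_induct)
  case (insert e B)
  have "perc_mean p (A \<union> insert e B) f = perc_mean p (insert e (A \<union> B)) f" by simp
  also have "\<dots> = p * perc_mean p (A \<union> B) (\<lambda>H. f (insert e H)) + (1 - p) * perc_mean p (A \<union> B) f"
    using insert assms(1) by (intro perc_mean_insert) auto
  also have "\<dots> = perc_mean p A (\<lambda>H. perc_mean p (insert e B) (\<lambda>K. f (H \<union> K)))"
    using insert by (simp add: perc_mean_insert perc_mean_add perc_mean_cmult)
  finally show ?case .
qed simp

lemma pmf_percolate:
  assumes "finite G" "H \<subseteq> G" "0 \<le> p" "p \<le> 1"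
  shows "pmf (percolate p G) H = p ^ card H * (1 - p) ^ card (G - H)"
proof -
  let ?M = "Pi_pmf G False (\<lambda>_. bernoulli_pmf p)"
  have "pmf (percolate p G) H = measure ?M ((\<lambda>kept. {e \<in> G. kept e}) -` {H})"
    by (simp add: percolate_def pmf_map)
  also have "\<dots> = measure ?M {\<lambda>e. e \<in> H}"
    using assms(2) set_Pi_pmf_subset[OF assms(1), of False "\<lambda>_. bernoulli_pmf p"]
    by (intro measure_pmf.finite_measure_eq_AE) (auto simp: AE_measure_pmf_iff fun_eq_iff)
  also have "\<dots> = (\<Prod>e\<in>G. pmf (bernoulli_pmf p) (e \<in> H))"
    using assms by (auto simp: measure_pmf_single pmf_Pi)
  also have "\<dots> = (\<Prod>e\<in>H. pmf (bernoulli_pmf p) (e \<in> H)) * (\<Prod>e\<in>G - H. pmf (bernoulli_pmf p) (e \<in> H))"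
    using assms by (metis prod.subset_diff mult.commute)
  also have "\<dots> = p ^ card H * (1 - p) ^ card (G - H)"
    using assms by simp
  finally show ?thesis .
qed

lemma set_pmf_percolate: "set_pmf (percolate p G) \<subseteq> Pow G"
  by (auto simp: percolate_def)

lemma expectation_percolate:
  assumes "finite G" "0 \<le> p" "p \<le> 1"
  shows "measure_pmf.expectation (percolate p G) f = perc_mean p G f"
proof -
  have "measure_pmf.expectation (percolate p G) f = (\<Sum>H\<in>Pow G. f H * pmf (percolate p G) H)"
    using assms set_pmf_percolate[of p G] by (intro integral_measure_pmf_real) auto
  also have "\<dots> = perc_mean p G f"
    unfolding perc_mean_def using assms by (intro sum.cong) (auto simp: pmf_percolate)
  finally show ?thesis .
qed

lemma simple_graph_edge: "simple_graph n G \<Longrightarrow> {x, y} \<in> G \<Longrightarrow> x \<noteq> y \<and> x \<in> {1..n} \<and> y \<in> {1..n}"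
  by (force simp: simple_graph_def)

lemma simple_graph_finite: "simple_graph n G \<Longrightarrow> finite G"
  by (rule finite_subset[of _ "Pow {1..n}"]) (auto simp: simple_graph_def)

lemma finite_realizations: "finite (realizations n D)"
  by (rule finite_subset[of _ "Pow (Pow {1..n})"]) (auto simp: simple_graph_def realizations_def)

lemma realizations_finite: "G \<in> realizations n D \<Longrightarrow> finite G"
  using simple_graph_finite by (auto simp: realizations_def)

text \<open>The mean over the pair of the random graph \<open>G\<close> and its percolated subgraph \<open>H\<close>. The pair is
  needed because a switching is admissible or not depending on the edges of \<open>G\<close> outside \<open>H\<close>.\<close>

definition joint_mean ::
    "nat \<Rightarrow> (nat \<Rightarrow> nat) \<Rightarrow> real \<Rightarrow> (nat set set \<Rightarrow> nat set set \<Rightarrow> real) \<Rightarrow> real" where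
  "joint_mean n D p f = (\<Sum>G\<in>realizations n D. perc_mean p G (f G)) / card (realizations n D)"

lemma prob_percolated_random_graph:
  assumes "realizations n D \<noteq> {}" "0 \<le> p" "p \<le> 1"
  shows "measure_pmf.prob (percolated_random_graph n D p) {H. P H} = joint_mean n D p (\<lambda>G H. of_bool (P H))"
proof -
  have fin: "finite (set_pmf (percolate p G))" if "G \<in> realizations n D" for G
    using set_pmf_percolate[of p G] realizations_finite[OF that] by (meson finite_Pow_iff finite_subset)
  have "measure_pmf.prob (percolated_random_graph n D p) {H. P H}
     = measure_pmf.expectation (percolated_random_graph n D p) (\<lambda>H. of_bool (P H))"
  proof -
    have "(\<lambda>H. of_bool (P H) :: real) = indicator {H. P H}"
      by (auto simp: fun_eq_iff)
    then show ?thesis by simp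
  qed
  also have "\<dots> = (\<Sum>G\<in>realizations n D. measure_pmf.expectation (percolate p G) (\<lambda>H. of_bool (P H))
       /\<^sub>R card (realizations n D))"
    unfolding percolated_random_graph_def random_graph_def
    using assms finite_realizations fin by (intro pmf_expectation_bind_pmf_of_set) auto
  also have "\<dots> = joint_mean n D p (\<lambda>G H. of_bool (P H))"
    using assms by (simp add: joint_mean_def sum_distrib_left[symmetric] expectation_percolate
      realizations_finite divide_inverse mult.commute)
  finally show ?thesis .
qed

lemma joint_mean_mono:
  assumes "0 \<le> p" "p \<le> 1"
    "\<And>G H. G \<in> realizations n D \<Longrightarrow> H \<subseteq> G \<Longrightarrow> f G H \<le> g G H"
  shows "joint_mean n D p f \<le> joint_mean n D p g"
  unfolding joint_mean_def using assms by (auto intro!: divide_right_mono sum_mono perc_mean_mono)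

lemma joint_mean_bound:
  assumes "\<And>G. G \<in> realizations n D \<Longrightarrow> perc_mean p G (f G) \<le> c" "0 \<le> c"
  shows "joint_mean n D p f \<le> c"
proof -
  have "(\<Sum>G\<in>realizations n D. perc_mean p G (f G)) \<le> card (realizations n D) * c"
    using assms by (intro sum_bounded_above) auto
  then show ?thesis
    using assms(2) by (cases "card (realizations n D) = 0") (auto simp: joint_mean_def field_simps)
qed

lemma joint_mean_add:
  "joint_mean n D p (\<lambda>G H. f G H + g G H) = joint_mean n D p f + joint_mean n D p g"
  by (simp add: joint_mean_def perc_mean_add sum.distrib add_divide_distrib)

lemma joint_mean_cmult: "joint_mean n D p (\<lambda>G H. c * f G H) = c * joint_mean n D p f"
  by (simp add: joint_mean_def perc_mean_cmult sum_distrib_left)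

lemma joint_mean_sum:
  "joint_mean n D p (\<lambda>G H. \<Sum>i\<in>I. f i G H) = (\<Sum>i\<in>I. joint_mean n D p (f i))"
  unfolding joint_mean_def perc_mean_sum sum_divide_distrib[symmetric]
  by (subst sum.swap) simp

lemma joint_mean_one:
  assumes "realizations n D \<noteq> {}"
  shows "joint_mean n D p (\<lambda>G H. 1) = 1"
  using assms finite_realizations[of n D] realizations_finite
  by (simp add: joint_mean_def perc_mean_const)

section \<open>Connectivity and bridges\<close>

definition connected_in :: "'a set set \<Rightarrow> 'a \<Rightarrow> 'a \<Rightarrow> bool" where
  "connected_in E x y \<longleftrightarrow> (x, y) \<in> {(x, y). {x, y} \<in> E}\<^sup>*"

lemma connected_in_refl [simp]: "connected_in E x x"
  by (simp add: connected_in_def)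

lemma connected_in_trans: "connected_in E x y \<Longrightarrow> connected_in E y z \<Longrightarrow> connected_in E x z"
  by (simp add: connected_in_def)

lemma connected_in_sym: "connected_in E x y \<longleftrightarrow> connected_in E y x"
proof -
  have "sym {(x, y). {x, y} \<in> E}" by (auto simp: sym_def insert_commute)
  then show ?thesis unfolding connected_in_def by (meson sym_rtrancl symD)
qed

lemma connected_in_edge: "{x, y} \<in> E \<Longrightarrow> connected_in E x y"
  by (auto simp: connected_in_def)

lemma connected_in_mono: "connected_in E x y \<Longrightarrow> E \<subseteq> F \<Longrightarrow> connected_in F x y"
  unfolding connected_in_def by (erule rtrancl_mono[THEN subsetD, rotated]) auto

lemma connected_in_cong: "connected_in E x y \<Longrightarrow> connected_in E x z \<longleftrightarrow> connected_in E y z"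
  by (metis connected_in_sym connected_in_trans)

text \<open>An edge between connected vertices leaves all components unchanged.\<close>

lemma connected_in_insert_redundant:
  assumes "connected_in E a b"
  shows "connected_in (insert {a, b} E) x y \<longleftrightarrow> connected_in E x y"
proof
  assume "connected_in (insert {a, b} E) x y"
  moreover have "{(x, y). {x, y} \<in> insert {a, b} E} \<subseteq> {(x, y). {x, y} \<in> E}\<^sup>*"
    using assms connected_in_sym[of E a b] by (auto simp: connected_in_def doubleton_eq_iff)
  ultimately show "connected_in E x y"
    unfolding connected_in_def by (meson rtrancl_subset_rtrancl subsetD)
qed (auto intro: connected_in_mono)

lemma sum_of_bool_pairs:
  assumes "finite A" "finite B"
  shows "(\<Sum>x\<in>A. \<Sum>y\<in>B. of_bool (P x y) :: real) = card {(x, y) \<in> A \<times> B. P x y}"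
proof -
  have "(\<Sum>x\<in>A. \<Sum>y\<in>B. of_bool (P x y) :: real) = (\<Sum>z\<in>A \<times> B. of_bool (case z of (x, y) \<Rightarrow> P x y))"
    by (simp add: sum.cartesian_product case_prod_unfold)
  also have "\<dots> = card ((A \<times> B) \<inter> {z. case z of (x, y) \<Rightarrow> P x y})"
    using assms by (intro sum_of_bool_eq) auto
  also have "(A \<times> B) \<inter> {z. case z of (x, y) \<Rightarrow> P x y} = {(x, y) \<in> A \<times> B. P x y}"
    by auto
  finally show ?thesis .
qed

lemma card_oriented_edges:
  assumes "finite E" "\<And>e. e \<in> E \<Longrightarrow> card e = 2"
  shows "finite {(x, y). {x, y} \<in> E} \<and> card {(x, y). {x, y} \<in> E} = 2 * card E"
  using assms
proof (induction E rule: finite_induct)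
  case (insert e E)
  obtain u v where e: "e = {u, v}" "u \<noteq> v"
    using insert.prems[of e] by (auto simp: card_2_iff)
  have eq: "{(x, y). {x, y} \<in> insert e E} = {(u, v), (v, u)} \<union> {(x, y). {x, y} \<in> E}"
    by (auto simp: e doubleton_eq_iff)
  have "{(u, v), (v, u)} \<inter> {(x, y). {x, y} \<in> E} = {}"
    using insert.hyps by (auto simp: e insert_commute)
  then have "card {(x, y). {x, y} \<in> insert e E} = card {(u, v), (v, u)} + card {(x, y). {x, y} \<in> E}"
    unfolding eq using insert by (intro card_Un_disjoint) auto
  then show ?case using insert e unfolding eq by auto
qed simp

text \<open>Insert the edges of a forest one at a time: each of them joins two classes of \<open>S\<close> that were
  different, so the number of classes drops with every edge.\<close>

lemma card_forest_le:
  assumes "finite S" "finite B"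
    "\<And>e. e \<in> B \<Longrightarrow> \<exists>x\<in>S. \<exists>y\<in>S. e = {x, y} \<and> \<not> connected_in (B - {e}) x y"
  shows "card B + card ((\<lambda>v. {u \<in> S. connected_in B v u}) ` S) \<le> card S"
  using assms(2,3)
proof (induction B rule: finite_induct)
  case empty
  then show ?case using assms(1) by (simp add: card_image_le)
next
  case (insert e B)
  define cls where "cls F v = {u \<in> S. connected_in F v u}" for F v
  define up where "up X = (\<Union>u\<in>X. cls (insert e B) u)" for X
  obtain x y where xy: "x \<in> S" "y \<in> S" "e = {x, y}" "\<not> connected_in B x y"
    using insert.prems[of e] insert.hyps by auto
  have IH: "card B + card (cls B ` S) \<le> card S"
    unfolding cls_def
  proof (rule insert.IH)
    fix f assume f: "f \<in> B"
    then obtain u v where "u \<in> S" "v \<in> S" "f = {u, v}" "\<not> connected_in (insert e B - {f}) u v"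
      using insert.prems[of f] by auto
    then show "\<exists>x\<in>S. \<exists>y\<in>S. f = {x, y} \<and> \<not> connected_in (B - {f}) x y"
      using connected_in_mono[of "B - {f}" u v "insert e B - {f}"] by blast
  qed
  have up: "up (cls B v) = cls (insert e B) v" if "v \<in> S" for v
  proof -
    have step: "connected_in (insert e B) v w" if "connected_in B v u" "connected_in (insert e B) u w" for u w
      using connected_in_trans[OF connected_in_mono[OF that(1)] that(2)] by blast
    show ?thesis
    proof
      show "up (cls B v) \<subseteq> cls (insert e B) v"
        using step by (auto simp: up_def cls_def)
      have "v \<in> cls B v" using that by (simp add: cls_def)
      then show "cls (insert e B) v \<subseteq> up (cls B v)"
        unfolding up_def by blast
    qed
  qed
  have img: "cls (insert e B) ` S = up ` cls B ` S"
    using up by (simp add: image_image cong: image_cong)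
  \<comment> \<open>The new edge merges the classes of its two ends, so \<open>up\<close> identifies two classes.\<close>
  have "\<not> inj_on up (cls B ` S)"
  proof
    assume inj: "inj_on up (cls B ` S)"
    have "connected_in (insert e B) x w \<longleftrightarrow> connected_in (insert e B) y w" for w
      by (rule connected_in_cong[OF connected_in_edge]) (simp add: xy)
    then have "cls (insert e B) x = cls (insert e B) y"
      by (simp add: cls_def)
    then have "up (cls B x) = up (cls B y)"
      by (simp only: up[OF xy(1)] up[OF xy(2)])
    then have "cls B x = cls B y"
      by (rule inj_onD[OF inj]) (use xy in auto)
    moreover have "y \<in> cls B y" using xy by (simp add: cls_def)
    ultimately have "y \<in> cls B x" by simp
    then show False using xy by (simp add: cls_def)
  qed
  then have "card (cls (insert e B) ` S) < card (cls B ` S)"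
    unfolding img using assms(1) by (meson card_image_le eq_card_imp_inj_on finite_imageI le_neq_implies_less)
  then show ?case using IH insert.hyps by (simp add: cls_def)
qed

text \<open>The bridges of a graph form a forest. The factor \<open>2\<close> comes from counting each bridge in both
  orientations. Vertices outside \<open>S\<close> may carry further edges of \<open>H\<close>; deleting these keeps the
  bridges inside \<open>S\<close> disconnecting.\<close>

lemma bridge_count:
  assumes "finite S"
  shows "(\<Sum>x\<in>S. \<Sum>y\<in>S. of_bool ({x, y} \<in> H \<and> \<not> connected_in (H - {{x, y}}) x y) :: real)
    \<le> 2 * card S"
proof -
  define P where "P = {(x, y) \<in> S \<times> S. {x, y} \<in> H \<and> \<not> connected_in (H - {{x, y}}) x y}"
  define B where "B = (\<lambda>(x, y). {x, y}) ` P"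
  have "finite P" unfolding P_def by (rule finite_subset[of _ "S \<times> S"]) (use assms in auto)
  then have finB: "finite B" by (simp add: B_def)
  have BH: "B \<subseteq> H" by (auto simp: B_def P_def)
  have "card B \<le> card S"
  proof -
    have "\<exists>x\<in>S. \<exists>y\<in>S. e = {x, y} \<and> \<not> connected_in (B - {e}) x y" if "e \<in> B" for e
    proof -
      obtain x y where xy: "e = {x, y}" "x \<in> S" "y \<in> S" "\<not> connected_in (H - {e}) x y"
        using \<open>e \<in> B\<close> by (auto simp: B_def P_def)
      then show ?thesis using connected_in_mono[of "B - {e}" x y "H - {e}"] BH by blast
    qed
    from card_forest_le[OF assms finB this] show ?thesis by simp
  qed
  moreover have "finite {(x, y). {x, y} \<in> B} \<and> card {(x, y). {x, y} \<in> B} = 2 * card B"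
  proof (rule card_oriented_edges[OF finB])
    fix e assume "e \<in> B"
    then obtain x y where "e = {x, y}" "\<not> connected_in (H - {{x, y}}) x y"
      by (auto simp: B_def P_def)
    then show "card e = 2" by (cases "x = y") auto
  qed
  moreover have "P \<subseteq> {(x, y). {x, y} \<in> B}" by (auto simp: B_def)
  ultimately have "card P \<le> 2 * card S"
    using card_mono[of "{(x, y). {x, y} \<in> B}" P] by linarith
  then show ?thesis
    unfolding sum_of_bool_pairs[OF assms assms] P_def[symmetric] by linarith
qed

section \<open>Edges below an apex\<close>

text \<open>Bernoulli's inequality bounds \<open>p k\<close> by \<open>(1 + p) ^ k\<close>, and \<open>(1 + p) (1 - p) \<le> 1\<close>.\<close>

lemma power_decay:
  assumes "0 \<le> p" "p \<le> (1::real)"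
  shows "p * real k * (1 - p) ^ k \<le> 1"
proof -
  have "p * real k \<le> (1 + p) ^ k"
    using Bernoulli_inequality[of p k] assms by (simp add: mult.commute)
  then have "p * real k * (1 - p) ^ k \<le> (1 + p) ^ k * (1 - p) ^ k"
    using assms by (intro mult_right_mono) auto
  also have "\<dots> = (1 - p\<^sup>2) ^ k"
    by (simp add: power_mult_distrib[symmetric] algebra_simps power2_eq_square)
  also have "\<dots> \<le> 1"
    using assms by (intro power_le_one) (auto simp: power_le_one)
  finally show ?thesis .
qed

text \<open>Whether \<open>x\<close> and \<open>y\<close> are connected by the edges other than \<open>{x, y}\<close> is independent of whether
  \<open>{x, y}\<close> is kept, and if they are, keeping the edge does not affect a weight that depends on the
  components only.\<close>

lemma nonbridge_mean_le:
  fixes w :: "'a set set \<Rightarrow> real"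
  assumes G: "finite G" and p: "0 \<le> p" "p \<le> 1" and w: "\<And>H. 0 \<le> w H"
    "\<And>H. connected_in H x y \<Longrightarrow> w (insert {x, y} H) = w H"
  shows "perc_mean p G (\<lambda>H. of_bool ({x, y} \<in> H \<and> connected_in (H - {{x, y}}) x y) * w H)
    \<le> p * perc_mean p G (\<lambda>H. of_bool (connected_in H x y) * w H)"
proof (cases "{x, y} \<in> G")
  case True
  let ?e = "{x, y}"
  let ?m = "perc_mean p (G - {?e}) (\<lambda>H. of_bool (connected_in H x y) * w H)"
  have "perc_mean p G (\<lambda>H. of_bool (?e \<in> H \<and> connected_in (H - {?e}) x y) * w H)
      = perc_mean p G (\<lambda>H. of_bool (?e \<in> H) * (of_bool (connected_in (H - {?e}) x y) * w H))"
    by (rule perc_mean_cong) auto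
  also have "\<dots> = p * perc_mean p (G - {?e})
      (\<lambda>H. of_bool (connected_in (insert ?e H - {?e}) x y) * w (insert ?e H))"
    by (rule perc_mean_kept[OF G True])
  also have "\<dots> = p * ?m"
  proof -
    have "insert ?e H - {?e} = H" if "H \<subseteq> G - {?e}" for H using that by auto
    then have "perc_mean p (G - {?e})
      (\<lambda>H. of_bool (connected_in (insert ?e H - {?e}) x y) * w (insert ?e H)) = ?m"
      by (intro perc_mean_cong) (auto simp: w(2))
    then show ?thesis by simp
  qed
  also have "\<dots> \<le> p * perc_mean p G (\<lambda>H. of_bool (connected_in H x y) * w H)"
  proof (rule mult_left_mono[OF _ p(1)])
    have "?m \<le> perc_mean p (G - {?e}) (\<lambda>H. of_bool (connected_in (insert ?e H) x y) * w (insert ?e H))"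
      using w p by (intro perc_mean_mono) (auto simp: connected_in_edge)
    then have "p * ?m + (1 - p) * ?m \<le> p * perc_mean p (G - {?e})
        (\<lambda>H. of_bool (connected_in (insert ?e H) x y) * w (insert ?e H)) + (1 - p) * ?m"
      using p by (intro add_right_mono mult_left_mono)
    then show "?m \<le> perc_mean p G (\<lambda>H. of_bool (connected_in H x y) * w H)"
      using perc_mean_split[OF G True, of p "\<lambda>H. of_bool (connected_in H x y) * w H"]
      by (simp add: algebra_simps)
  qed
  finally show ?thesis .
next
  case False
  have "perc_mean p G (\<lambda>H. of_bool ({x, y} \<in> H \<and> connected_in (H - {{x, y}}) x y) * w H) 
      = perc_mean p G (\<lambda>_. 0)"
    using False by (intro perc_mean_cong) auto
  moreover have "perc_mean p G (\<lambda>_. 0) \<le> perc_mean p G (\<lambda>H. of_bool (connected_in H x y) * w H)"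
    using w p by (intro perc_mean_mono) auto
  ultimately show ?thesis using p G by (simp add: perc_mean_const)
qed

text \<open>The bridges inside \<open>T\<close> contribute at most \<open>2 |T|\<close>, since the weights are at most \<open>1\<close>. For the other
  edges the previous lemma replaces ``\<open>{x, y}\<close> is kept'' by a factor \<open>p\<close> and ``\<open>x\<close> and \<open>y\<close> are
  connected''. For given \<open>x\<close> there are then only as many choices of \<open>y\<close> as the exponent of the
  weight says, so each \<open>x\<close> contributes at most \<open>p k (1 - p) ^ k \<le> 1\<close>.\<close>

lemma class_weighted_edges_le:
  fixes G :: "'a set set"
  assumes G: "finite G" and T: "finite T" and p: "0 \<le> p" "p \<le> 1"
  shows "perc_mean p G (\<lambda>H. \<Sum>x\<in>T. \<Sum>y\<in>T. of_bool ({x, y} \<in> H) * (1 - p) ^ card {z \<in> T. connected_in H x z})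
    \<le> 3 * card T"
proof -
  define w where "w x H = (1 - p) ^ card {z \<in> T. connected_in H x z}" for x H
  have w0: "0 \<le> w x H" and w1: "w x H \<le> 1" for x H
    using p by (auto simp: w_def intro: power_le_one)
  have winv: "w x (insert {x, y} H) = w x H" if "connected_in H x y" for x y H
    using connected_in_insert_redundant[OF that] by (simp add: w_def)
  have "perc_mean p G (\<lambda>H. \<Sum>x\<in>T. \<Sum>y\<in>T. of_bool ({x, y} \<in> H) * w x H)
    \<le> perc_mean p G (\<lambda>H. 2 * card T +
        (\<Sum>x\<in>T. \<Sum>y\<in>T. of_bool ({x, y} \<in> H \<and> connected_in (H - {{x, y}}) x y) * w x H))"
  proof (rule perc_mean_mono[OF p])
    fix H
    have "(\<Sum>x\<in>T. \<Sum>y\<in>T. of_bool ({x, y} \<in> H) * w x H)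
      \<le> (\<Sum>x\<in>T. \<Sum>y\<in>T. of_bool ({x, y} \<in> H \<and> \<not> connected_in (H - {{x, y}}) x y)
          + of_bool ({x, y} \<in> H \<and> connected_in (H - {{x, y}}) x y) * w x H)"
      using w0 w1 by (intro sum_mono) auto
    also have "\<dots> \<le> 2 * card T +
        (\<Sum>x\<in>T. \<Sum>y\<in>T. of_bool ({x, y} \<in> H \<and> connected_in (H - {{x, y}}) x y) * w x H)"
      using bridge_count[OF T, of H] by (simp add: sum.distrib)
    finally show "(\<Sum>x\<in>T. \<Sum>y\<in>T. of_bool ({x, y} \<in> H) * w x H) \<le> \<dots>" .
  qed
  also have "\<dots> = 2 * card T + (\<Sum>x\<in>T. \<Sum>y\<in>T. perc_mean p G
      (\<lambda>H. of_bool ({x, y} \<in> H \<and> connected_in (H - {{x, y}}) x y) * w x H))"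
    by (simp add: perc_mean_add perc_mean_const G perc_mean_sum)
  also have "\<dots> \<le> 2 * card T + (\<Sum>x\<in>T. \<Sum>y\<in>T. p * perc_mean p G
      (\<lambda>H. of_bool (connected_in H x y) * w x H))"
    using w0 winv by (intro add_left_mono sum_mono nonbridge_mean_le[OF G p]) auto
  also have "\<dots> = 2 * card T + perc_mean p G (\<lambda>H. \<Sum>x\<in>T. p * card {z \<in> T. connected_in H x z} * w x H)"
  proof -
    have "(\<Sum>y\<in>T. of_bool (connected_in H x y)) = (real (card {z \<in> T. connected_in H x z}))" for H x
      using T by (simp add: sum_of_bool_eq Int_def)
    then show ?thesis
      by (simp add: perc_mean_sum[symmetric] perc_mean_cmult[symmetric] sum_distrib_left[symmetric] 
        sum_distrib_right[symmetric] mult.assoc)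
  qed
  also have "\<dots> \<le> 2 * card T + perc_mean p G (\<lambda>H. \<Sum>x\<in>T. 1)"
    unfolding w_def by (intro add_left_mono perc_mean_mono[OF p] sum_mono power_decay[OF p])
  also have "\<dots> = 3 * card T" using G by (simp add: perc_mean_const)
  finally show ?thesis by (simp add: w_def)
qed

text \<open>Here \<open>H\<close> is the percolated graph away from the apex \<open>a\<close>, and \<open>B\<close> is the set of edges at \<open>a\<close>, still
  to be percolated. If \<open>a\<close> ends up separated from \<open>x\<close>, then all edges from \<open>a\<close> to the component
  of \<open>x\<close> are lost; the edge to \<open>u\<close> is not among them and gives the additional factor \<open>p\<close>.\<close>

lemma apex_escape_le:
  fixes K0 :: "'a set set"
  assumes B: "finite B" "\<And>e. e \<in> B \<Longrightarrow> a \<in> e" and p: "0 \<le> p" "p \<le> 1"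
    and T: "finite T" "\<And>z. z \<in> T \<Longrightarrow> {a, z} \<in> B" "a \<notin> T" and xy: "x \<in> T" "y \<in> T"
    and H: "\<And>e. e \<in> H \<Longrightarrow> a \<notin> e"
  shows "perc_mean p B (\<lambda>K. of_bool ({a, u} \<in> H \<union> K \<and> {x, y} \<in> H \<union> K \<and> \<not> connected_in (H \<union> K) a x))
     \<le> of_bool ({x, y} \<in> H) * (p * (1 - p) ^ card {z \<in> T. connected_in H x z})"
    (is "perc_mean p B ?f \<le> ?r")
proof -
  define A where "A = (\<lambda>z. {a, z}) ` {z \<in> T. connected_in H x z}"
  have AB: "A \<subseteq> B" using T by (auto simp: A_def)
  have cardA: "card A = card {z \<in> T. connected_in H x z}"
    unfolding A_def by (intro card_image) (auto simp: inj_on_def doubleton_eq_iff)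
  have r0: "0 \<le> ?r" using p by auto
  have zero: "perc_mean p B (\<lambda>_. 0) = 0" using B by (simp add: perc_mean_const)
  have hit: "{x, y} \<in> H \<and> K \<inter> A = {} \<and> {a, u} \<in> K"
    if "K \<subseteq> B" "{a, u} \<in> H \<union> K" "{x, y} \<in> H \<union> K" "\<not> connected_in (H \<union> K) a x" for K
  proof -
    have "a \<notin> {x, y}" using xy T(3) by auto
    then have "{x, y} \<in> H" using that(1,3) B(2) by blast
    moreover have "{a, u} \<in> K" using H that(2) by blast
    moreover have "K \<inter> A = {}"
    proof (rule ccontr)
      assume "K \<inter> A \<noteq> {}"
      then obtain z where "connected_in H x z" "{a, z} \<in> K" by (auto simp: A_def)
      then have "connected_in (H \<union> K) a z" "connected_in (H \<union> K) z x"
        using connected_in_sym[of H x z] connected_in_edge[of a z "H \<union> K"]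
        by (auto intro: connected_in_mono[of H])
      then show False using that(4) connected_in_trans by metis
    qed
    ultimately show ?thesis by auto
  qed
  show ?thesis
  proof (cases "{a, u} \<in> B \<and> {a, u} \<notin> A")
    case True
    have "perc_mean p B ?f
        \<le> perc_mean p B (\<lambda>K. of_bool ({x, y} \<in> H) * (of_bool ({a, u} \<in> K) * of_bool (K \<inter> A = {})))"
      using hit p by (intro perc_mean_mono) auto
    also have "\<dots> = of_bool ({x, y} \<in> H) * (p * perc_mean p (B - {{a, u}}) (\<lambda>K. of_bool (insert {a, u} K \<inter> A = {})))"
      using True B by (simp add: perc_mean_cmult perc_mean_kept)
    also have "(\<lambda>K. of_bool (insert {a, u} K \<inter> A = {}) :: real) = (\<lambda>K. of_bool (K \<inter> A = {}))"
      using True by auto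
    also have "perc_mean p (B - {{a, u}}) (\<lambda>K. of_bool (K \<inter> A = {})) = (1 - p) ^ card A"
      using B AB True by (intro perc_mean_avoid) auto
    finally show ?thesis by (simp add: cardA)
  next
    case False
    have "\<not> ({a, u} \<in> H \<union> K \<and> {x, y} \<in> H \<union> K \<and> \<not> connected_in (H \<union> K) a x)" if "K \<subseteq> B" for K
      using hit[OF that] False that by blast
    then have "perc_mean p B ?f = perc_mean p B (\<lambda>_. 0)"
      by (intro perc_mean_cong) auto
    then show ?thesis using r0 zero by simp
  qed
qed

lemma apex_mean_le:
  fixes G :: "'a set set" and p :: real
  assumes G: "finite G" and p: "0 \<le> p" "p \<le> 1"
    and T: "finite T" "\<And>z. z \<in> T \<Longrightarrow> {a, z} \<in> G" "a \<notin> T"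
  shows "perc_mean p G (\<lambda>H. \<Sum>u\<in>U. \<Sum>x\<in>T. \<Sum>y\<in>T.
      of_bool ({a, u} \<in> H \<and> {x, y} \<in> H \<and> \<not> connected_in H a x)) \<le> card U * (3 * p * card T)"
proof -
  define A where "A = {e \<in> G. a \<notin> e}"
  define B where "B = {e \<in> G. a \<in> e}"
  have AB: "finite A" "finite B" "A \<inter> B = {}" "G = A \<union> B" using G by (auto simp: A_def B_def)
  let ?c = "\<lambda>H x. (1 - p) ^ card {z \<in> T. connected_in H x z}"
  have "perc_mean p G (\<lambda>H. \<Sum>u\<in>U. \<Sum>x\<in>T. \<Sum>y\<in>T.
      of_bool ({a, u} \<in> H \<and> {x, y} \<in> H \<and> \<not> connected_in H a x))
    = perc_mean p A (\<lambda>H. \<Sum>u\<in>U. \<Sum>x\<in>T. \<Sum>y\<in>T. perc_mean p B (\<lambda>K.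
      of_bool ({a, u} \<in> H \<union> K \<and> {x, y} \<in> H \<union> K \<and> \<not> connected_in (H \<union> K) a x)))"
    unfolding AB(4) perc_mean_Un[OF AB(1-3)] by (simp add: perc_mean_sum)
  also have "\<dots> \<le> perc_mean p A (\<lambda>H. \<Sum>u\<in>U. \<Sum>x\<in>T. \<Sum>y\<in>T. of_bool ({x, y} \<in> H) * (p * ?c H x))"
  proof (intro perc_mean_mono[OF p] sum_mono)
    fix H u x y assume "H \<subseteq> A" "x \<in> T" "y \<in> T"
    then show "perc_mean p B (\<lambda>K.
        of_bool ({a, u} \<in> H \<union> K \<and> {x, y} \<in> H \<union> K \<and> \<not> connected_in (H \<union> K) a x))
      \<le> of_bool ({x, y} \<in> H) * (p * ?c H x)"
      using T by (intro apex_escape_le[OF AB(2) _ p T(1)]) (auto simp: A_def B_def)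
  qed
  also have "\<dots> = perc_mean p A (\<lambda>H. (card U * p) * (\<Sum>x\<in>T. \<Sum>y\<in>T. of_bool ({x, y} \<in> H) * ?c H x))"
    by (simp add: sum_distrib_left algebra_simps)
  also have "\<dots> = (card U * p) * perc_mean p A (\<lambda>H. \<Sum>x\<in>T. \<Sum>y\<in>T. of_bool ({x, y} \<in> H) * ?c H x)"
    by (rule perc_mean_cmult)
  also have "\<dots> \<le> (card U * p) * (3 * card T)"
    using p by (intro mult_left_mono class_weighted_edges_le[OF AB(1) T(1) p]) auto
  finally show ?thesis by (simp add: algebra_simps)
qed

section \<open>Switchings\<close>

lemma sum_neighbours:
  assumes "G \<in> realizations n D" "x \<in> {1..n}"
  shows "(\<Sum>y\<in>{1..n}. of_bool ({x, y} \<in> G) :: real) = D x"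
proof -
  have sg: "simple_graph n G" and deg: "vertex_degree G x = D x"
    using assms by (auto simp: realizations_def)
  have "bij_betw (\<lambda>y. {x, y}) {y \<in> {1..n}. {x, y} \<in> G} {e \<in> G. x \<in> e}"
  proof (rule bij_betwI')
    fix e assume "e \<in> {e \<in> G. x \<in> e}"
    then have e: "e \<in> G" "x \<in> e" "card e = 2" using sg by (auto simp: simple_graph_def)
    then obtain y where "e = {x, y}" by (auto simp: card_2_iff)
    then show "\<exists>y\<in>{y \<in> {1..n}. {x, y} \<in> G}. e = {x, y}"
      using e simple_graph_edge[OF sg, of x y] by auto
  qed (auto simp: doubleton_eq_iff)
  then have "card {y \<in> {1..n}. {x, y} \<in> G} = D x"
    using deg by (simp add: bij_betw_same_card vertex_degree_def)
  then show ?thesis by (simp add: sum_of_bool_eq Int_def)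
qed

lemma sum_oriented_edges:
  assumes "simple_graph n G"
  shows "(\<Sum>x\<in>{1..n}. \<Sum>y\<in>{1..n}. of_bool ({x, y} \<in> G) :: real) = 2 * real (card G)"
proof -
  have "(\<Sum>x\<in>{1..n}. \<Sum>y\<in>{1..n}. of_bool ({x, y} \<in> G) :: real)
      = card {(x, y) \<in> {1..n} \<times> {1..n}. {x, y} \<in> G}"
    by (rule sum_of_bool_pairs) auto
  also have "{(x, y) \<in> {1..n} \<times> {1..n}. {x, y} \<in> G} = {(x, y). {x, y} \<in> G}"
    using simple_graph_edge[OF assms] by auto
  also have "card \<dots> = 2 * card G"
    using card_oriented_edges[OF simple_graph_finite[OF assms]] assms by (auto simp: simple_graph_def)
  finally show ?thesis by simp
qed

lemma sum_degrees:
  assumes "G \<in> realizations n D"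
  shows "real (\<Sum>v\<in>{1..n}. D v) = 2 * real (card G)"
proof -
  have "simple_graph n G" using assms by (auto simp: realizations_def)
  from sum_oriented_edges[OF this] show ?thesis
    using sum_neighbours[OF assms] by simp
qed

definition switch :: "nat \<Rightarrow> nat \<Rightarrow> nat \<Rightarrow> nat \<Rightarrow> nat set set \<Rightarrow> nat set set" where
  "switch a b c d G = (G - {{a, b}, {c, d}}) \<union> {{a, c}, {b, d}}"

lemma switch_realization:
  assumes G: "G \<in> realizations n D" and old: "{a, b} \<in> G" "{c, d} \<in> G"
    and new: "{a, c} \<notin> G" "{b, d} \<notin> G" and neq: "distinct [a, b, c, d]"
  shows "switch a b c d G \<in> realizations n D"
proof -
  have sg: "simple_graph n G" using G by (auto simp: realizations_def)
  have fin: "finite G" using simple_graph_finite[OF sg] .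
  have "vertex_degree (switch a b c d G) v = vertex_degree G v" for v
  proof -
    have deg: "vertex_degree E v = (\<Sum>e\<in>E. of_bool (v \<in> e))" if "finite E" for E
      using that by (simp add: vertex_degree_def sum_of_bool_eq Int_def)
    have "(\<Sum>e\<in>switch a b c d G. of_bool (v \<in> e)) =
        (\<Sum>e\<in>G - {{a, b}, {c, d}}. of_bool (v \<in> e)) + (\<Sum>e\<in>{{a, c}, {b, d}}. of_bool (v \<in> e) :: nat)"
      unfolding switch_def using fin new by (intro sum.union_disjoint) auto
    also have "(\<Sum>e\<in>{{a, c}, {b, d}}. of_bool (v \<in> e) :: nat) = (\<Sum>e\<in>{{a, b}, {c, d}}. of_bool (v \<in> e))"
    proof -
      have two: "(\<Sum>e\<in>{e1, e2}. g e) = g e1 + g e2" if "e1 \<noteq> e2" for g :: "nat set \<Rightarrow> nat" and e1 e2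
        using that by simp
      have ne: "{a, c} \<noteq> {b, d}" "{a, b} \<noteq> {c, d}" using neq by (auto simp: doubleton_eq_iff)
      show ?thesis unfolding two[OF ne(1)] two[OF ne(2)] using neq by auto
    qed
    also have "(\<Sum>e\<in>G - {{a, b}, {c, d}}. of_bool (v \<in> e)) + \<dots> = (\<Sum>e\<in>G. of_bool (v \<in> e))"
      using fin old by (intro sum.subset_diff[symmetric]) auto
    finally show ?thesis using fin by (simp add: deg switch_def)
  qed
  moreover have "simple_graph n (switch a b c d G)"
  proof -
    have "card {a, c} = 2" "card {b, d} = 2" "{a, b, c, d} \<subseteq> {1..n}"
      using neq simple_graph_edge[OF sg old(1)] simple_graph_edge[OF sg old(2)] by auto
    then show ?thesis using sg by (auto simp: simple_graph_def switch_def)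
  qed
  ultimately show ?thesis using G by (auto simp: realizations_def)
qed

lemma switch_inverse:
  assumes "{a, b} \<in> G" "{c, d} \<in> G" "{a, c} \<notin> G" "{b, d} \<notin> G"
  shows "switch a c b d (switch a b c d G) = G"
  using assms by (auto simp: switch_def)

lemma card_switch:
  assumes "finite H" "{a, b} \<in> H" "{c, d} \<in> H" "{a, c} \<notin> H" "{b, d} \<notin> H" "distinct [a, b, c, d]"
  shows "card (switch a b c d H) = card H"
proof -
  have two: "card {{a, b}, {c, d}} = 2" "card {{a, c}, {b, d}} = 2"
    using assms(6) by (auto simp: doubleton_eq_iff)
  have "card (switch a b c d H) = card (H - {{a, b}, {c, d}}) + card {{a, c}, {b, d}}"
    unfolding switch_def using assms by (intro card_Un_disjoint) auto
  also have "card (H - {{a, b}, {c, d}}) = card H - 2"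
    using assms two by (subst card_Diff_subset) auto
  also have "2 \<le> card H"
    using card_mono[OF assms(1), of "{{a, b}, {c, d}}"] assms two by auto
  ultimately show ?thesis using two by simp
qed

lemma joint_mean_Sigma:
  "joint_mean n D p (\<lambda>G H. of_bool (P G H)) =
    (\<Sum>(G, H)\<in>{(G, H) \<in> Sigma (realizations n D) Pow. P G H}. p ^ card H * (1 - p) ^ card (G - H))
      / card (realizations n D)"
proof -
  have fin: "finite (Sigma (realizations n D) Pow)"
    using finite_realizations[of n D] realizations_finite[of _ n D] by auto
  have "(\<Sum>G\<in>realizations n D. perc_mean p G (\<lambda>H. of_bool (P G H)))
     = (\<Sum>(G, H)\<in>Sigma (realizations n D) Pow. p ^ card H * (1 - p) ^ card (G - H) * of_bool (P G H))"
    unfolding perc_mean_def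
    using finite_realizations[of n D] realizations_finite[of _ n D] by (subst sum.Sigma) auto
  also have "\<dots> = (\<Sum>(G, H)\<in>{(G, H) \<in> Sigma (realizations n D) Pow. P G H}. p ^ card H * (1 - p) ^ card (G - H))"
    by (rule sum.mono_neutral_cong_right[OF fin]) auto
  finally show ?thesis by (simp add: joint_mean_def)
qed

text \<open>Switching \<open>G\<close> and \<open>H\<close> simultaneously is injective, since the switching that exchanges \<open>b\<close> and \<open>c\<close>
  undoes it. It preserves the weight, because \<open>H\<close> keeps its size and \<open>G - H\<close> does not change. In the
  new \<open>H\<close> the vertices \<open>b\<close> and \<open>d\<close> are connected by the two new edges only, as they were in
  different components before.\<close>

lemma switching_mean_le:
  assumes p: "0 \<le> p" "p \<le> 1"
  shows "joint_mean n D p (\<lambda>G H. of_bool ({a, b} \<in> H \<and> {c, d} \<in> H \<and> \<not> connected_in H a c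
        \<and> {a, c} \<notin> G \<and> {b, d} \<notin> G))
    \<le> joint_mean n D p (\<lambda>G H. of_bool ({a, c} \<in> H \<and> {b, d} \<in> H - {{a, c}}
        \<and> \<not> connected_in (H - {{a, c}} - {{b, d}}) b d))"
proof -
  define src where "src = {(G, H) \<in> Sigma (realizations n D) Pow. {a, b} \<in> H \<and> {c, d} \<in> H
    \<and> \<not> connected_in H a c \<and> {a, c} \<notin> G \<and> {b, d} \<notin> G}"
  define tgt where "tgt = {(G, H) \<in> Sigma (realizations n D) Pow. {a, c} \<in> H \<and> {b, d} \<in> H - {{a, c}}
        \<and> \<not> connected_in (H - {{a, c}} - {{b, d}}) b d}"
  define w where "w = (\<lambda>(G :: nat set set, H :: nat set set). p ^ card H * (1 - p) ^ card (G - H))"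
  define sw where "sw = map_prod (switch a b c d) (switch a b c d)"
  have fin: "finite (Sigma (realizations n D) Pow)"
    using finite_realizations[of n D] realizations_finite[of _ n D] by auto
  have facts: "distinct [a, b, c, d] \<and> \<not> connected_in H b d" if "(G, H) \<in> src" for G H
  proof -
    have H: "{a, b} \<in> H" "{c, d} \<in> H" "\<not> connected_in H a c" "simple_graph n G" "H \<subseteq> G"
      using that by (auto simp: src_def realizations_def)
    have ab: "connected_in H a b" "connected_in H c d"
      using H by (auto intro: connected_in_edge)
    then have bd: "\<not> connected_in H b d"
      using H(3) connected_in_cong connected_in_sym by metis
    moreover have "a \<noteq> b" "c \<noteq> d" using H simple_graph_edge[of n G] by blast+
    moreover have "a \<noteq> c" "b \<noteq> d" using H(3) bd by auto
    moreover have "a \<noteq> d" "b \<noteq> c" using H(3) ab connected_in_sym by metis+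
    ultimately show ?thesis by auto
  qed
  have inj: "inj_on sw src"
  proof (rule inj_on_inverseI)
    fix z assume "z \<in> src"
    then obtain G H where z: "z = (G, H)" and GH: "H \<subseteq> G" "{a, b} \<in> H" "{c, d} \<in> H" "{a, c} \<notin> G" "{b, d} \<notin> G"
      by (auto simp: src_def)
    have "switch a c b d (switch a b c d G) = G"
      by (rule switch_inverse) (use GH in auto)
    moreover have "switch a c b d (switch a b c d H) = H"
      by (rule switch_inverse) (use GH in auto)
    ultimately show "map_prod (switch a c b d) (switch a c b d) (sw z) = z"
      by (simp add: sw_def z)
  qed
  have main: "sw z \<in> tgt \<and> w (sw z) = w z" if "z \<in> src" for z
  proof -
    obtain G H where z: "z = (G, H)" by (cases z)
    have GH: "G \<in> realizations n D" "H \<subseteq> G" "{a, b} \<in> H" "{c, d} \<in> H" "{a, c} \<notin> G" "{b, d} \<notin> G"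
      using \<open>z \<in> src\<close> by (auto simp: src_def z)
    have f: "distinct [a, b, c, d]" "\<not> connected_in H b d"
      using facts \<open>z \<in> src\<close> z by auto
    have neq: "{a, c} \<noteq> {b, d}" using f by (auto simp: doubleton_eq_iff)
    have "switch a b c d H - {{a, c}} - {{b, d}} \<subseteq> H" by (auto simp: switch_def)
    then have "\<not> connected_in (switch a b c d H - {{a, c}} - {{b, d}}) b d"
      using f(2) connected_in_mono[of _ b d H] by blast
    moreover have "switch a b c d G \<in> realizations n D"
      using GH f by (intro switch_realization) auto
    moreover have "switch a b c d H \<subseteq> switch a b c d G" using GH by (auto simp: switch_def)
    moreover have "{a, c} \<in> switch a b c d H" "{b, d} \<in> switch a b c d H" by (auto simp: switch_def)
    ultimately have tgt: "sw z \<in> tgt" using neq by (auto simp: tgt_def sw_def z)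
    have "switch a b c d G - switch a b c d H = G - H"
      using GH by (auto simp: switch_def)
    moreover have "card (switch a b c d H) = card H"
    proof (rule card_switch)
      show "finite H" using finite_subset[OF GH(2)] realizations_finite[OF GH(1)] .
    qed (use GH f in auto)
    ultimately show ?thesis using tgt by (simp add: w_def sw_def z)
  qed
  have "sum w src = sum w (sw ` src)"
    using main by (simp add: sum.reindex[OF inj])
  also have "\<dots> \<le> sum w tgt"
  proof (rule sum_mono2)
    show "finite tgt" by (rule finite_subset[OF _ fin]) (auto simp: tgt_def)
    show "sw ` src \<subseteq> tgt" using main by blast
  qed (use p in \<open>auto simp: w_def\<close>)
  finally have "sum w src / card (realizations n D) \<le> sum w tgt / card (realizations n D)"
    by (intro divide_right_mono) auto
  then show ?thesis
    unfolding joint_mean_Sigma src_def tgt_def w_def .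
qed

section \<open>Separated pairs of edges\<close>

text \<open>The four nested sums are given a name so that a permutation of the summation variables can be
  applied as a rewrite rule.\<close>

definition quad_sum :: "'a set \<Rightarrow> ('a \<Rightarrow> 'a \<Rightarrow> 'a \<Rightarrow> 'a \<Rightarrow> real) \<Rightarrow> real" where
  "quad_sum V f = (\<Sum>a\<in>V. \<Sum>b\<in>V. \<Sum>c\<in>V. \<Sum>d\<in>V. f a b c d)"

lemma quad_sum_mono:
  assumes "\<And>a b c d. \<lbrakk>a \<in> V; b \<in> V; c \<in> V; d \<in> V\<rbrakk> \<Longrightarrow> f a b c d \<le> g a b c d"
  shows "quad_sum V f \<le> quad_sum V g"
  unfolding quad_sum_def using assms by (intro sum_mono) auto

lemma quad_sum_add: "quad_sum V (\<lambda>a b c d. f a b c d + g a b c d) = quad_sum V f + quad_sum V g"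
  by (simp add: quad_sum_def sum.distrib)

lemma quad_sum_swap_last: "quad_sum V (\<lambda>a b c d. f a b d c) = quad_sum V f"
  unfolding quad_sum_def by (intro sum.cong refl sum.swap)

lemma quad_sum_swap_first: "quad_sum V (\<lambda>a b c d. f b a c d) = quad_sum V f"
  unfolding quad_sum_def by (rule sum.swap)

lemma quad_sum_swap_pairs: "quad_sum V (\<lambda>a b c d. f c d a b) = quad_sum V f"
proof -
  have pairs: "(\<Sum>c\<in>V. \<Sum>d\<in>V. g c d) = (\<Sum>w\<in>V \<times> V. g (fst w) (snd w))" for g :: "'a \<Rightarrow> 'a \<Rightarrow> real"
    by (simp add: sum.cartesian_product split_def)
  show ?thesis
    unfolding quad_sum_def pairs by (rule sum.swap)
qed

lemma joint_mean_quad_sum: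
  "joint_mean n D p (\<lambda>G H. quad_sum V (f G H)) = quad_sum V (\<lambda>a b c d. joint_mean n D p (\<lambda>G H. f G H a b c d))"
  by (simp add: quad_sum_def joint_mean_sum)

lemma perc_mean_quad_sum:
  "perc_mean p G (\<lambda>H. quad_sum V (f H)) = quad_sum V (\<lambda>a b c d. perc_mean p G (\<lambda>H. f H a b c d))"
  by (simp add: quad_sum_def perc_mean_sum)

lemma sum_of_bool_mem_mult:
  assumes "finite V" "S \<subseteq> V"
  shows "(\<Sum>x\<in>V. of_bool (x \<in> S) * f x) = (\<Sum>x\<in>S. f x :: real)"
  using assms by (intro sum.mono_neutral_cong_right) auto

lemma quad_sum_split:
  assumes "finite V" "S \<subseteq> V" "\<And>a b c d. 0 \<le> f a b c d"
  shows "quad_sum V f \<le> quad_sum S f + quad_sum V (\<lambda>a b c d. of_bool (a \<notin> S) * f a b c d)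
    + quad_sum V (\<lambda>a b c d. of_bool (b \<notin> S) * f a b c d)
    + quad_sum V (\<lambda>a b c d. of_bool (c \<notin> S) * f a b c d)
    + quad_sum V (\<lambda>a b c d. of_bool (d \<notin> S) * f a b c d)"
proof -
  have "quad_sum V f \<le> quad_sum V (\<lambda>a b c d.
      of_bool (a \<in> S) * (of_bool (b \<in> S) * (of_bool (c \<in> S) * (of_bool (d \<in> S) * f a b c d)))
      + of_bool (a \<notin> S) * f a b c d + of_bool (b \<notin> S) * f a b c d
      + of_bool (c \<notin> S) * f a b c d + of_bool (d \<notin> S) * f a b c d)"
    using assms(3) by (intro quad_sum_mono) auto
  also have "quad_sum V (\<lambda>a b c d.
      of_bool (a \<in> S) * (of_bool (b \<in> S) * (of_bool (c \<in> S) * (of_bool (d \<in> S) * f a b c d)))) = quad_sum S f"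
    by (simp only: quad_sum_def sum_distrib_left[symmetric] sum_of_bool_mem_mult[OF assms(1,2)])
  then show ?thesis using calculation by (simp add: quad_sum_add)
qed

definition separated :: "'a set set \<Rightarrow> 'a \<Rightarrow> 'a \<Rightarrow> 'a \<Rightarrow> 'a \<Rightarrow> bool" where
  "separated H a b c d \<longleftrightarrow> {a, b} \<in> H \<and> {c, d} \<in> H \<and> \<not> connected_in H a c"

lemma separated_sym:
  "separated H b a c d \<longleftrightarrow> separated H a b c d"
  "separated H a b d c \<longleftrightarrow> separated H a b c d"
  "separated H c d a b \<longleftrightarrow> separated H a b c d"
proof -
  show "separated H b a c d \<longleftrightarrow> separated H a b c d"
    using connected_in_cong[OF connected_in_edge, of a b H c]
    by (auto simp: separated_def insert_commute)
  show "separated H a b d c \<longleftrightarrow> separated H a b c d"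
    using connected_in_cong[OF connected_in_edge, of c d H a] connected_in_sym[of H c a] connected_in_sym[of H d a]
    by (auto simp: separated_def insert_commute)
  show "separated H c d a b \<longleftrightarrow> separated H a b c d"
    using connected_in_sym[of H c a] by (auto simp: separated_def)
qed

definition apex :: "'a set set \<Rightarrow> 'a set set \<Rightarrow> 'a \<Rightarrow> 'a \<Rightarrow> 'a \<Rightarrow> 'a \<Rightarrow> bool" where
  "apex G H a u x y \<longleftrightarrow> separated H a u x y \<and> {a, x} \<in> G \<and> {a, y} \<in> G"

definition switchable :: "'a set set \<Rightarrow> 'a set set \<Rightarrow> 'a \<Rightarrow> 'a \<Rightarrow> 'a \<Rightarrow> 'a \<Rightarrow> bool" where
  "switchable G H a b c d \<longleftrightarrow> separated H a b c d \<and> {a, c} \<notin> G \<and> {b, d} \<notin> G"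

text \<open>If both switchings are blocked, each by an edge of \<open>G\<close> between \<open>{a, b}\<close> and \<open>{c, d}\<close>, then the two
  blocking edges share an end, and this common end is an apex.\<close>

lemma separated_cases:
  assumes "separated H a b c d"
  shows "switchable G H a b c d \<or> switchable G H a b d c \<or> apex G H a b c d \<or> apex G H b a c d
    \<or> apex G H c d a b \<or> apex G H d c a b"
proof -
  have s: "separated H b a c d" "separated H a b d c" "separated H c d a b" "separated H d c a b"
    using assms by (simp_all only: separated_sym)
  have c: "{c, a} = {a, c}" "{c, b} = {b, c}" "{d, a} = {a, d}" "{d, b} = {b, d}"
    by (auto simp: insert_commute)
  show ?thesis
    unfolding switchable_def apex_def c using assms s by blast
qed

text \<open>After the switching, the edge \<open>ac\<close> can be any edge inside \<open>S\<close>, and for each of them \<open>bd\<close> is one of at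
  most \<open>|S|\<close> bridges of the remaining graph.\<close>

lemma sum_switchable_le:
  assumes p: "0 \<le> p" "p \<le> 1" and S: "S \<subseteq> {1..n}"
  shows "joint_mean n D p (\<lambda>G H. quad_sum S (\<lambda>a b c d. of_bool (switchable G H a b c d)))
    \<le> 2 * p * card S * (\<Sum>v\<in>{1..n}. D v)"
proof -
  have fS: "finite S" using S finite_subset by blast
  let ?rev = "\<lambda>H a b c d. of_bool ({a, c} \<in> H \<and> {b, d} \<in> H - {{a, c}}
        \<and> \<not> connected_in (H - {{a, c}} - {{b, d}}) b d) :: real"
  have "joint_mean n D p (\<lambda>G H. quad_sum S (\<lambda>a b c d. of_bool (switchable G H a b c d)))
     = quad_sum S (\<lambda>a b c d. joint_mean n D p (\<lambda>G H. of_bool (switchable G H a b c d)))"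
    by (rule joint_mean_quad_sum)
  also have "\<dots> \<le> quad_sum S (\<lambda>a b c d. joint_mean n D p (\<lambda>G H. ?rev H a b c d))"
    using switching_mean_le[OF p, of n D]
    by (intro quad_sum_mono) (simp add: switchable_def separated_def conj_assoc)
  also have "\<dots> = joint_mean n D p (\<lambda>G H. quad_sum S (?rev H))"
    by (rule joint_mean_quad_sum[symmetric])
  also have "\<dots> \<le> 2 * p * card S * (\<Sum>v\<in>{1..n}. D v)"
  proof (rule joint_mean_bound)
    fix G assume G: "G \<in> realizations n D"
    have "perc_mean p G (\<lambda>H. quad_sum S (?rev H))
      \<le> perc_mean p G (\<lambda>H. (\<Sum>a\<in>S. \<Sum>c\<in>S. of_bool ({a, c} \<in> H)) * (2 * real (card S)))"
    proof (rule perc_mean_mono[OF p])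
      fix H
      \<comment> \<open>Fix the edge \<open>ac\<close> first, then count the bridges \<open>bd\<close>.\<close>
      have "quad_sum S (?rev H) = (\<Sum>a\<in>S. \<Sum>c\<in>S. \<Sum>b\<in>S. \<Sum>d\<in>S. ?rev H a b c d)"
        unfolding quad_sum_def by (intro sum.cong refl sum.swap)
      also have "\<dots> = (\<Sum>a\<in>S. \<Sum>c\<in>S. of_bool ({a, c} \<in> H) * (\<Sum>b\<in>S. \<Sum>d\<in>S. 
          of_bool ({b, d} \<in> H - {{a, c}} \<and> \<not> connected_in (H - {{a, c}} - {{b, d}}) b d)))"
        unfolding sum_distrib_left by (intro sum.cong refl) auto
      also have "\<dots> \<le> (\<Sum>a\<in>S. \<Sum>c\<in>S. of_bool ({a, c} \<in> H) * (2 * real (card S)))"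
      proof (intro sum_mono mult_left_mono)
        fix a c
        show "(\<Sum>b\<in>S. \<Sum>d\<in>S. of_bool ({b, d} \<in> H - {{a, c}}
            \<and> \<not> connected_in (H - {{a, c}} - {{b, d}}) b d)) \<le> 2 * real (card S)"
          using bridge_count[OF fS, of "H - {{a, c}}"] by (simp only: of_nat_mult of_nat_numeral)
      qed simp
      finally show "quad_sum S (?rev H) \<le> (\<Sum>a\<in>S. \<Sum>c\<in>S. of_bool ({a, c} \<in> H)) * (2 * real (card S))"
        by (simp only: sum_distrib_right)
    qed
    also have "\<dots> = (\<Sum>a\<in>S. \<Sum>c\<in>S. perc_mean p G (\<lambda>H. of_bool ({a, c} \<in> H))) * (2 * real (card S))"
      by (simp only: perc_mean_cmult_right perc_mean_sum)
    also have "\<dots> \<le> (\<Sum>a\<in>S. \<Sum>c\<in>S. p * of_bool ({a, c} \<in> G)) * (2 * real (card S))"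
    proof (intro mult_right_mono sum_mono)
      fix a c
      show "perc_mean p G (\<lambda>H. of_bool ({a, c} \<in> H)) \<le> p * of_bool ({a, c} \<in> G)"
      proof (cases "{a, c} \<in> G")
        case True
        then show ?thesis using perc_mean_edge[OF realizations_finite[OF G] True, of p] by simp
      next
        case False
        then have "perc_mean p G (\<lambda>H. of_bool ({a, c} \<in> H)) = perc_mean p G (\<lambda>_. 0)"
          by (intro perc_mean_cong) auto
        then show ?thesis using False realizations_finite[OF G] by (simp add: perc_mean_const)
      qed
    qed auto
    also have "\<dots> \<le> (\<Sum>a\<in>{1..n}. \<Sum>c\<in>{1..n}. p * of_bool ({a, c} \<in> G)) * (2 * real (card S))"
    proof (rule mult_right_mono)
      have "(\<Sum>a\<in>S. \<Sum>c\<in>S. p * of_bool ({a, c} \<in> G)) \<le> (\<Sum>a\<in>S. \<Sum>c\<in>{1..n}. p * of_bool ({a, c} \<in> G))"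
        using S p by (intro sum_mono sum_mono2) auto
      also have "\<dots> \<le> (\<Sum>a\<in>{1..n}. \<Sum>c\<in>{1..n}. p * of_bool ({a, c} \<in> G))"
        using S p by (intro sum_mono2 sum_nonneg) auto
      finally show "(\<Sum>a\<in>S. \<Sum>c\<in>S. p * of_bool ({a, c} \<in> G)) \<le> \<dots>" .
    qed simp
    also have "\<dots> = 2 * p * card S * (\<Sum>v\<in>{1..n}. D v)"
      using sum_neighbours[OF G] by (simp add: sum_distrib_left[symmetric])
    finally show "perc_mean p G (\<lambda>H. quad_sum S (?rev H)) \<le> 2 * p * card S * (\<Sum>v\<in>{1..n}. D v)" .
  qed (use p in \<open>auto intro!: mult_nonneg_nonneg sum_nonneg\<close>)
  finally show ?thesis .
qed

lemma sum_apex_le: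
  assumes p: "0 \<le> p" "p \<le> 1" and S: "S \<subseteq> {1..n}"
  shows "joint_mean n D p (\<lambda>G H. quad_sum S (\<lambda>a u x y. of_bool (apex G H a u x y)))
    \<le> 3 * p * card S * (\<Sum>v\<in>{1..n}. D v)"
proof (rule joint_mean_bound)
  have fS: "finite S" using S finite_subset by blast
  fix G assume G: "G \<in> realizations n D"
  have sg: "simple_graph n G" using G by (simp add: realizations_def)
  define N where "N a = {z \<in> S. {a, z} \<in> G}" for a
  have "perc_mean p G (\<lambda>H. quad_sum S (\<lambda>a u x y. of_bool (apex G H a u x y)))
    = perc_mean p G (\<lambda>H. \<Sum>a\<in>S. \<Sum>u\<in>N a. \<Sum>x\<in>N a. \<Sum>y\<in>N a.
       of_bool ({a, u} \<in> H \<and> {x, y} \<in> H \<and> \<not> connected_in H a x))"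
  proof (rule perc_mean_cong)
    fix H assume H: "H \<subseteq> G"
    let ?g = "\<lambda>a u x y. of_bool ({a, u} \<in> H \<and> {x, y} \<in> H \<and> \<not> connected_in H a x) :: real"
    have sub: "N a \<subseteq> S" for a by (auto simp: N_def)
    have "quad_sum S (\<lambda>a u x y. of_bool (apex G H a u x y))
      = (\<Sum>a\<in>S. \<Sum>u\<in>S. \<Sum>x\<in>S. \<Sum>y\<in>S. of_bool (u \<in> N a) * (of_bool (x \<in> N a) * (of_bool (y \<in> N a) * ?g a u x y)))"
      unfolding quad_sum_def
      by (intro sum.cong refl) (use H in \<open>auto simp: apex_def separated_def N_def\<close>)
    also have "\<dots> = (\<Sum>a\<in>S. \<Sum>u\<in>N a. \<Sum>x\<in>N a. \<Sum>y\<in>N a. ?g a u x y)"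
      by (simp only: sum_distrib_left[symmetric] sum_of_bool_mem_mult[OF fS sub])
    finally show "quad_sum S (\<lambda>a u x y. of_bool (apex G H a u x y)) = \<dots>" .
  qed
  also have "\<dots> = (\<Sum>a\<in>S. perc_mean p G (\<lambda>H. \<Sum>u\<in>N a. \<Sum>x\<in>N a. \<Sum>y\<in>N a.
       of_bool ({a, u} \<in> H \<and> {x, y} \<in> H \<and> \<not> connected_in H a x)))"
    by (rule perc_mean_sum)
  also have "\<dots> \<le> (\<Sum>a\<in>S. card (N a) * (3 * p * card (N a)))"
  proof (intro sum_mono apex_mean_le[OF realizations_finite[OF G] p])
    fix a
    show "a \<notin> N a" using simple_graph_edge[OF sg, of a a] by (auto simp: N_def)
  qed (use fS in \<open>auto simp: N_def\<close>)
  also have "\<dots> \<le> (\<Sum>a\<in>S. real (D a) * (3 * p * card S))"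
  proof (intro sum_mono mult_mono mult_left_mono)
    fix a assume a: "a \<in> S"
    have "real (card (N a)) = (\<Sum>z\<in>S. of_bool ({a, z} \<in> G))"
      using fS by (simp add: N_def sum_of_bool_eq Int_def)
    also have "\<dots> \<le> (\<Sum>z\<in>{1..n}. of_bool ({a, z} \<in> G))"
      using S by (intro sum_mono2) auto
    also have "\<dots> = D a" using sum_neighbours[OF G] a S by blast
    finally show "real (card (N a)) \<le> D a" .
    show "real (card (N a)) \<le> card S"
      using fS by (auto simp: N_def intro!: card_mono)
  qed (use p in auto)
  also have "\<dots> \<le> (\<Sum>a\<in>{1..n}. real (D a) * (3 * p * card S))"
    using S p by (intro sum_mono2) auto
  also have "\<dots> = 3 * p * card S * (\<Sum>v\<in>{1..n}. D v)"
    by (simp add: sum_distrib_left mult.commute)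
  finally show "perc_mean p G (\<lambda>H. quad_sum S (\<lambda>a u x y. of_bool (apex G H a u x y)))
    \<le> 3 * p * card S * (\<Sum>v\<in>{1..n}. D v)" .
qed (use p in \<open>auto intro!: mult_nonneg_nonneg sum_nonneg\<close>)

text \<open>Two different edges are both kept with probability \<open>p\<^sup>2\<close>, and separated edges are different.\<close>

lemma sum_separated_outside_le:
  assumes p: "0 \<le> p" "p \<le> 1"
  shows "joint_mean n D p (\<lambda>G H. quad_sum {1..n} (\<lambda>a b c d. of_bool (a \<notin> S) * of_bool (separated H a b c d)))
    \<le> p\<^sup>2 * (\<Sum>v\<in>{1..n} - S. D v) * (\<Sum>v\<in>{1..n}. D v)"
proof (rule joint_mean_bound)
  fix G assume G: "G \<in> realizations n D"
  have fin: "finite G" by (rule realizations_finite[OF G])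
  have pair: "perc_mean p G (\<lambda>H. of_bool (separated H a b c d))
      \<le> p\<^sup>2 * (of_bool ({a, b} \<in> G) * of_bool ({c, d} \<in> G))" for a b c d
  proof (cases "{a, b} \<in> G \<and> {c, d} \<in> G \<and> {a, b} \<noteq> {c, d}")
    case True
    have "perc_mean p G (\<lambda>H. of_bool (separated H a b c d))
        \<le> perc_mean p G (\<lambda>H. of_bool ({a, b} \<in> H) * of_bool ({c, d} \<in> H))"
      by (rule perc_mean_mono[OF p]) (auto simp: separated_def)
    also have "\<dots> = p\<^sup>2" using True fin by (intro perc_mean_two_edges) auto
    finally show ?thesis using True by simp
  next
    case False
    have "\<not> separated H a b c d" if "H \<subseteq> G" for H
    proof
      assume s: "separated H a b c d"
      then have eq: "{a, b} = {c, d}" using that False by (auto simp: separated_def)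
      have "connected_in H a b" using s by (auto simp: separated_def intro: connected_in_edge)
      then show False using s eq by (auto simp: separated_def doubleton_eq_iff)
    qed
    then have "perc_mean p G (\<lambda>H. of_bool (separated H a b c d)) = perc_mean p G (\<lambda>_. 0)"
      by (intro perc_mean_cong) auto
    then show ?thesis using fin by (simp add: perc_mean_const)
  qed
  have "perc_mean p G (\<lambda>H. quad_sum {1..n} (\<lambda>a b c d. of_bool (a \<notin> S) * of_bool (separated H a b c d)))
    = quad_sum {1..n} (\<lambda>a b c d. of_bool (a \<notin> S) * perc_mean p G (\<lambda>H. of_bool (separated H a b c d)))"
    by (simp only: perc_mean_quad_sum perc_mean_cmult)
  also have "\<dots> \<le> quad_sum {1..n} (\<lambda>a b c d. of_bool (a \<in> {1..n} - S) *
      (p\<^sup>2 * (of_bool ({a, b} \<in> G) * of_bool ({c, d} \<in> G))))"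
  proof (rule quad_sum_mono)
    fix a b c d assume "a \<in> {1..n}"
    then have eq: "of_bool (a \<notin> S) = (of_bool (a \<in> {1..n} - S) :: real)" by auto
    show "of_bool (a \<notin> S) * perc_mean p G (\<lambda>H. of_bool (separated H a b c d)) \<le>
        of_bool (a \<in> {1..n} - S) * (p\<^sup>2 * (of_bool ({a, b} \<in> G) * of_bool ({c, d} \<in> G)))"
      unfolding eq by (intro mult_left_mono pair) auto
  qed
  also have "\<dots> = (\<Sum>a\<in>{1..n}. of_bool (a \<in> {1..n} - S) * (p\<^sup>2 * ((\<Sum>b\<in>{1..n}. of_bool ({a, b} \<in> G))
      * (\<Sum>c\<in>{1..n}. \<Sum>d\<in>{1..n}. of_bool ({c, d} \<in> G)))))"
    by (simp only: quad_sum_def sum_distrib_left[symmetric] sum_distrib_right[symmetric])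
  also have "\<dots> = (\<Sum>a\<in>{1..n} - S. p\<^sup>2 * ((\<Sum>b\<in>{1..n}. of_bool ({a, b} \<in> G))
      * (\<Sum>c\<in>{1..n}. \<Sum>d\<in>{1..n}. of_bool ({c, d} \<in> G))))"
    by (rule sum_of_bool_mem_mult) auto
  also have "\<dots> = (\<Sum>a\<in>{1..n} - S. p\<^sup>2 * (D a * (\<Sum>v\<in>{1..n}. D v)))"
    using sum_neighbours[OF G] by (intro sum.cong refl) (auto simp del: One_nat_def)
  also have "\<dots> = p\<^sup>2 * (\<Sum>v\<in>{1..n} - S. D v) * (\<Sum>v\<in>{1..n}. D v)"
    by (simp only: of_nat_sum of_nat_mult sum_distrib_left[symmetric] sum_distrib_right[symmetric] mult.assoc)
  finally show "perc_mean p G (\<lambda>H. quad_sum {1..n} (\<lambda>a b c d. of_bool (a \<notin> S) * of_bool (separated H a b c d)))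
    \<le> p\<^sup>2 * (\<Sum>v\<in>{1..n} - S. D v) * (\<Sum>v\<in>{1..n}. D v)" .
qed (use p in \<open>auto intro!: mult_nonneg_nonneg sum_nonneg\<close>)

text \<open>By the symmetries of separation, the two switchings contribute equally, as do the four choices of
  the apex and the four positions of a vertex outside \<open>S\<close>. This gives \<open>2 \<cdot> 2 + 4 \<cdot> 3 = 16\<close> for the first
  constant.\<close>

lemma separated_mean_le:
  assumes p: "0 \<le> p" "p \<le> 1" and S: "S \<subseteq> {1..n}"
  shows "joint_mean n D p (\<lambda>G H. quad_sum {1..n} (\<lambda>a b c d. of_bool (separated H a b c d)))
    \<le> 16 * p * card S * (\<Sum>v\<in>{1..n}. D v) + 4 * p\<^sup>2 * (\<Sum>v\<in>{1..n} - S. D v) * (\<Sum>v\<in>{1..n}. D v)"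
proof -
  let ?sep = "\<lambda>H a b c d. of_bool (separated H a b c d) :: real"
  let ?sw = "\<lambda>G H. quad_sum S (\<lambda>a b c d. of_bool (switchable G H a b c d))"
  let ?ap = "\<lambda>G H. quad_sum S (\<lambda>a b c d. of_bool (apex G H a b c d))"
  let ?out = "\<lambda>H. quad_sum {1..n} (\<lambda>a b c d. of_bool (a \<notin> S) * ?sep H a b c d)"
  have "quad_sum {1..n} (?sep H) \<le> 2 * ?sw G H + 4 * ?ap G H + 4 * ?out H" for G H
  proof -
    have "quad_sum {1..n} (?sep H) \<le> quad_sum S (?sep H) + ?out H
      + quad_sum {1..n} (\<lambda>a b c d. of_bool (b \<notin> S) * ?sep H a b c d)
      + quad_sum {1..n} (\<lambda>a b c d. of_bool (c \<notin> S) * ?sep H a b c d)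
      + quad_sum {1..n} (\<lambda>a b c d. of_bool (d \<notin> S) * ?sep H a b c d)"
      using S by (intro quad_sum_split) auto
    also have "quad_sum {1..n} (\<lambda>a b c d. of_bool (b \<notin> S) * ?sep H a b c d) = ?out H"
      by (subst quad_sum_swap_first[symmetric]) (simp only: separated_sym)
    also have "quad_sum {1..n} (\<lambda>a b c d. of_bool (d \<notin> S) * ?sep H a b c d)
        = quad_sum {1..n} (\<lambda>a b c d. of_bool (c \<notin> S) * ?sep H a b c d)"
      by (subst quad_sum_swap_last[symmetric]) (simp only: separated_sym)
    also have "quad_sum {1..n} (\<lambda>a b c d. of_bool (c \<notin> S) * ?sep H a b c d) = ?out H"
      by (subst quad_sum_swap_pairs[symmetric]) (simp only: separated_sym)
    also have "quad_sum S (?sep H) \<le> quad_sum S (\<lambda>a b c d.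
        of_bool (switchable G H a b c d) + of_bool (switchable G H a b d c)
        + of_bool (apex G H a b c d) + of_bool (apex G H b a c d)
        + of_bool (apex G H c d a b) + of_bool (apex G H d c a b))"
    proof (rule quad_sum_mono)
      fix a b c d
      show "?sep H a b c d \<le> of_bool (switchable G H a b c d) + of_bool (switchable G H a b d c)
        + of_bool (apex G H a b c d) + of_bool (apex G H b a c d)
        + of_bool (apex G H c d a b) + of_bool (apex G H d c a b)"
        using separated_cases[of H a b c d G] by (cases "separated H a b c d") auto
    qed
    also have "\<dots> = 2 * ?sw G H + 4 * ?ap G H"
    proof -
      have "quad_sum S (\<lambda>a b c d. of_bool (switchable G H a b d c)) = ?sw G H"
        by (rule quad_sum_swap_last)
      moreover have "quad_sum S (\<lambda>a b c d. of_bool (apex G H b a c d)) = ?ap G H"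
        by (rule quad_sum_swap_first)
      moreover have "quad_sum S (\<lambda>a b c d. of_bool (apex G H c d a b)) = ?ap G H"
        by (rule quad_sum_swap_pairs)
      moreover have "quad_sum S (\<lambda>a b c d. of_bool (apex G H d c a b)) = ?ap G H"
        by (subst quad_sum_swap_pairs[symmetric]) (rule quad_sum_swap_first)
      ultimately show ?thesis by (simp add: quad_sum_add)
    qed
    finally show ?thesis by simp
  qed
  then have "joint_mean n D p (\<lambda>G H. quad_sum {1..n} (?sep H))
    \<le> joint_mean n D p (\<lambda>G H. 2 * ?sw G H + 4 * ?ap G H + 4 * ?out H)"
    by (intro joint_mean_mono[OF p])
  also have "\<dots> = 2 * joint_mean n D p ?sw + 4 * joint_mean n D p ?ap + 4 * joint_mean n D p (\<lambda>G H. ?out H)"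
    by (simp only: joint_mean_add joint_mean_cmult)
  also have "\<dots> \<le> 2 * (2 * p * card S * (\<Sum>v\<in>{1..n}. D v)) + 4 * (3 * p * card S * (\<Sum>v\<in>{1..n}. D v))
      + 4 * (p\<^sup>2 * (\<Sum>v\<in>{1..n} - S. D v) * (\<Sum>v\<in>{1..n}. D v))"
    by (intro add_mono mult_left_mono sum_switchable_le sum_apex_le sum_separated_outside_le p S) auto
  finally show ?thesis by (simp add: algebra_simps)
qed

section \<open>A giant component from few separated pairs\<close>

lemma component_of_eq: "component_of n H v = {u \<in> {1..n}. connected_in H v u}"
  by (simp add: component_of_def connected_in_def)

text \<open>If every component contained fewer than the fraction \<open>1 - \<epsilon>\<close> of the edges, then for each edge more
  than the fraction \<open>\<epsilon>\<close> of all edges would be separated from it. Quadruples count oriented edges,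
  hence the factor \<open>2\<close>.\<close>

lemma giant_component_if_few_separated:
  assumes sg: "simple_graph n H" and n: "1 \<le> n"
    and few: "quad_sum {1..n} (\<lambda>a b c d. of_bool (separated H a b c d)) \<le> \<epsilon> * (2 * real (card H))\<^sup>2"
  shows "\<exists>C\<in>graph_components n H. (1 - \<epsilon>) * real (card H) \<le> real (card (edges_inside H C))"
proof (rule ccontr)
  assume none: "\<not> ?thesis"
  define V where "V = {1..n}"
  define h where "h = 2 * real (card H)"
  define m where "m = Max ((\<lambda>C. card (edges_inside H C)) ` graph_components n H)"
  have comps: "finite (graph_components n H)" "graph_components n H \<noteq> {}"
    using n by (auto simp: graph_components_def)
  have le_m: "card (edges_inside H C) \<le> m" if "C \<in> graph_components n H" for C
    unfolding m_def using comps that by (intro Max_ge) auto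
  have "m \<in> (\<lambda>C. card (edges_inside H C)) ` graph_components n H"
    unfolding m_def using comps by (intro Max_in) auto
  then have m: "real m < (1 - \<epsilon>) * real (card H)" using none by (auto simp: not_le)
  have "H \<noteq> {}"
    using m by auto
  then have h: "0 < h"
    using simple_graph_finite[OF sg] by (simp add: h_def card_gt_0_iff)
  have oriented: "(\<Sum>a\<in>V. \<Sum>b\<in>V. of_bool ({a, b} \<in> H)) = h"
    unfolding V_def h_def by (rule sum_oriented_edges[OF sg])
  let ?sep = "\<lambda>a b c d. of_bool (separated H a b c d) :: real"
  let ?joined = "\<lambda>a b c d. of_bool ({a, b} \<in> H) * of_bool ({c, d} \<in> edges_inside H (component_of n H a)) :: real"
  have "h * h = quad_sum V (\<lambda>a b c d. of_bool ({a, b} \<in> H) * of_bool ({c, d} \<in> H))"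
    unfolding quad_sum_def sum_distrib_left[symmetric] sum_distrib_right[symmetric] oriented ..
  also have "\<dots> \<le> quad_sum V (\<lambda>a b c d. ?sep a b c d + ?joined a b c d)"
  proof (rule quad_sum_mono)
    fix a b c d assume V: "a \<in> V" "b \<in> V" "c \<in> V" "d \<in> V"
    have "{c, d} \<in> edges_inside H (component_of n H a)" if "{c, d} \<in> H" "connected_in H a c"
      using that V connected_in_trans[OF that(2) connected_in_edge[OF that(1)]]
      by (auto simp: edges_inside_def component_of_eq V_def)
    then show "of_bool ({a, b} \<in> H) * of_bool ({c, d} \<in> H) \<le> ?sep a b c d + ?joined a b c d"
      by (auto simp: separated_def)
  qed
  also have "\<dots> = quad_sum V ?sep + quad_sum V ?joined"
    by (rule quad_sum_add)
  also have "quad_sum V ?joined \<le> (\<Sum>a\<in>V. \<Sum>b\<in>V. of_bool ({a, b} \<in> H) * (2 * real m))"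
    unfolding quad_sum_def sum_distrib_left[symmetric]
  proof (intro sum_mono mult_left_mono)
    fix a assume a: "a \<in> V"
    let ?E = "edges_inside H (component_of n H a)"
    have "simple_graph n ?E" using sg by (auto simp: simple_graph_def edges_inside_def)
    then have "(\<Sum>c\<in>V. \<Sum>d\<in>V. of_bool ({c, d} \<in> ?E)) = 2 * real (card ?E)"
      unfolding V_def by (rule sum_oriented_edges)
    then show "(\<Sum>c\<in>V. \<Sum>d\<in>V. of_bool ({c, d} \<in> ?E)) \<le> 2 * real m"
      using le_m[of "component_of n H a"] a by (simp add: graph_components_def V_def)
  qed simp
  also have "\<dots> = h * (2 * real m)"
    unfolding sum_distrib_right[symmetric] oriented ..
  finally have "h * h \<le> quad_sum V ?sep + h * (2 * real m)" by simp
  also have "quad_sum V ?sep \<le> \<epsilon> * (h * h)"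
    using few by (simp add: V_def h_def power2_eq_square)
  finally have "h * h \<le> h * (\<epsilon> * h + 2 * real m)" by (simp add: algebra_simps)
  moreover have "\<epsilon> * h + 2 * real m < h" using m by (simp add: h_def algebra_simps)
  ultimately show False using h mult_strict_left_mono[of _ h h] by fastforce
qed

section \<open>Second moments\<close>

lemma perc_mean_square_deviation:
  assumes "finite G"
  shows "perc_mean p G (\<lambda>H. ((\<Sum>i\<in>I. X i H) - (\<Sum>i\<in>I. perc_mean p G (X i)))\<^sup>2) =
    (\<Sum>i\<in>I. \<Sum>j\<in>I. perc_mean p G (\<lambda>H. X i H * X j H) - perc_mean p G (X i) * perc_mean p G (X j))"
proof -
  define \<mu> where "\<mu> = (\<Sum>i\<in>I. perc_mean p G (X i))"
  have "perc_mean p G (\<lambda>H. ((\<Sum>i\<in>I. X i H) - \<mu>)\<^sup>2)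
    = perc_mean p G (\<lambda>H. (\<Sum>i\<in>I. \<Sum>j\<in>I. X i H * X j H) - (2 * \<mu>) * (\<Sum>i\<in>I. X i H) + \<mu>\<^sup>2)"
    by (rule perc_mean_cong) (simp add: power2_diff power2_eq_square sum_product algebra_simps)
  also have "\<dots> = (\<Sum>i\<in>I. \<Sum>j\<in>I. perc_mean p G (\<lambda>H. X i H * X j H)) - (2 * \<mu>) * \<mu> + \<mu>\<^sup>2"
    unfolding \<mu>_def using assms
    by (simp only: perc_mean_add perc_mean_minus perc_mean_cmult perc_mean_sum perc_mean_const)
  also have "\<dots> = (\<Sum>i\<in>I. \<Sum>j\<in>I. perc_mean p G (\<lambda>H. X i H * X j H)) - \<mu> * \<mu>"
    by (simp add: power2_eq_square)
  finally show ?thesis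
    by (simp add: \<mu>_def sum_product sum_subtractf)
qed

text \<open>Chebyshev's inequality: the number of kept edges has mean \<open>p |G|\<close> and at most the same variance.\<close>

lemma few_kept_edges_le:
  assumes G: "finite G" and p: "0 \<le> p" "p \<le> 1" and pos: "0 < p * real (card G)"
  shows "perc_mean p G (\<lambda>H. of_bool (2 * real (card H) < p * real (card G))) \<le> 4 / (p * real (card G))"
proof -
  define m where "m = p * real (card G)"
  have "perc_mean p G (\<lambda>H. (real (card H) - m)\<^sup>2) = perc_mean p G (\<lambda>H. ((\<Sum>e\<in>G. of_bool (e \<in> H))
     - (\<Sum>e\<in>G. perc_mean p G (\<lambda>H. of_bool (e \<in> H))))\<^sup>2)"
  proof (rule perc_mean_cong)
    fix H assume "H \<subseteq> G"
    then have "(\<Sum>e\<in>G. of_bool (e \<in> H) :: real) = card H"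
      using G by (simp add: sum_of_bool_eq Int_absorb1)
    moreover have "(\<Sum>e\<in>G. perc_mean p G (\<lambda>H. of_bool (e \<in> H))) = m"
      using perc_mean_edge[OF G, of _ p] by (simp add: m_def)
    ultimately show "(real (card H) - m)\<^sup>2 = ((\<Sum>e\<in>G. of_bool (e \<in> H))
     - (\<Sum>e\<in>G. perc_mean p G (\<lambda>H. of_bool (e \<in> H))))\<^sup>2" by simp
  qed
  also have "\<dots> = (\<Sum>e\<in>G. \<Sum>f\<in>G. perc_mean p G (\<lambda>H. of_bool (e \<in> H) * of_bool (f \<in> H)) - p * p)"
    unfolding perc_mean_square_deviation[OF G]
    by (intro sum.cong refl) (simp add: perc_mean_edge[OF G])
  also have "\<dots> \<le> (\<Sum>e\<in>G. \<Sum>f\<in>G. of_bool (e = f) * p)"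
  proof (intro sum_mono)
    fix e f assume ef: "e \<in> G" "f \<in> G"
    show "perc_mean p G (\<lambda>H. of_bool (e \<in> H) * of_bool (f \<in> H)) - p * p \<le> of_bool (e = f) * p"
    proof (cases "e = f")
      case True
      have "perc_mean p G (\<lambda>H. of_bool (e \<in> H) * of_bool (e \<in> H)) = perc_mean p G (\<lambda>H. of_bool (e \<in> H))"
        by (rule perc_mean_cong) auto
      then show ?thesis using True perc_mean_edge[OF G ef(1), of p] p by simp
    next
      case False
      then show ?thesis using perc_mean_two_edges[OF G ef False, of p] by (simp add: power2_eq_square)
    qed
  qed
  also have "\<dots> = m"
    using G by (simp add: m_def sum_distrib_right[symmetric] if_distrib cong: if_cong)
  finally have var: "perc_mean p G (\<lambda>H. (real (card H) - m)\<^sup>2) \<le> m" .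
  have "perc_mean p G (\<lambda>H. of_bool (2 * real (card H) < m)) \<le> perc_mean p G (\<lambda>H. (4 / m\<^sup>2) * (real (card H) - m)\<^sup>2)"
  proof (rule perc_mean_mono[OF p])
    fix H
    show "of_bool (2 * real (card H) < m) \<le> (4 / m\<^sup>2) * (real (card H) - m)\<^sup>2"
    proof (cases "2 * real (card H) < m")
      case True
      then have "(m / 2)\<^sup>2 \<le> (m - real (card H))\<^sup>2" by (intro power_mono) auto
      then have "m\<^sup>2 \<le> 4 * (real (card H) - m)\<^sup>2"
        by (simp add: power_divide power2_commute)
      then show ?thesis using True pos by (simp add: m_def[symmetric] field_simps)
    qed simp
  qed
  also have "\<dots> \<le> (4 / m\<^sup>2) * m"
    unfolding perc_mean_cmult by (rule mult_left_mono[OF var]) auto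
  also have "\<dots> = 4 / m" by (simp add: power2_eq_square)
  finally show ?thesis by (simp add: m_def)
qed

text \<open>By Markov's inequality the number of separated quadruples exceeds \<open>\<delta> (p M / 2)\<^sup>2\<close> with probability
  at most \<open>\<delta>\<^sup>2 / \<delta>\<close>. Indeed the radicand of \<open>\<delta>\<close> is the bound of \<open>separated_mean_le\<close> divided by
  \<open>(p M / 2)\<^sup>2\<close>, with \<open>|S| / M\<close> replaced by the larger \<open>1 / d\<close>; the square root splits it evenly
  between error and probability. The term \<open>8 / (p d)\<close> accounts for \<open>H\<close> having fewer than half of the expected
  number of edges.\<close>

lemma giant_component_prob:
  fixes p d :: real and D :: "nat \<Rightarrow> nat"
  assumes R: "realizations n D \<noteq> {}" and p: "0 < p" "p \<le> 1" and d: "0 < d"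
    and S: "S \<subseteq> {1..n}" "S \<noteq> {}" "\<And>v. v \<in> S \<Longrightarrow> d \<le> D v"
  defines "\<delta> \<equiv> sqrt (64 / (p * d) + 16 * real (degree_sum D ({1..n} - S)) / real (degree_sum D {1..n}))"
  shows "1 - (8 / (p * d) + \<delta>) \<le> measure_pmf.prob (percolated_random_graph n D p)
    {H. \<exists>C\<in>graph_components n H. real (card (edges_inside H C)) \<ge> (1 - \<delta>) * real (card H)}"
proof -
  define M where "M = real (degree_sum D {1..n})"
  define W where "W = real (degree_sum D ({1..n} - S))"
  have fS: "finite S" using S finite_subset by blast
  have sM: "d * real (card S) \<le> M"
  proof -
    have "d * real (card S) \<le> (\<Sum>v\<in>S. real (D v))"
      using sum_bounded_below[of S d "\<lambda>v. real (D v)"] S(3) by (simp add: mult.commute)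
    also have "\<dots> \<le> (\<Sum>v\<in>{1..n}. real (D v))" using S(1) by (intro sum_mono2) auto
    finally show ?thesis by (simp add: M_def degree_sum_def)
  qed
  have "1 \<le> card S" using S(2) fS by (simp add: Suc_leI card_gt_0_iff)
  then have "d * 1 \<le> d * real (card S)" using d by (intro mult_left_mono) auto
  then have dM: "d \<le> M" using sM by linarith
  then have M: "0 < M" using d by simp
  have W: "0 \<le> W" by (simp add: W_def)
  have n: "1 \<le> n" using S by auto
  have dsq: "\<delta>\<^sup>2 = 64 / (p * d) + 16 * W / M"
    unfolding \<delta>_def W_def M_def using p d by simp
  have "0 < 64 / (p * d) + 16 * W / M" using p d M W by (intro add_pos_nonneg) auto
  then have dpos: "0 < \<delta>" unfolding \<delta>_def W_def M_def by simp
  let ?Q = "\<lambda>H. quad_sum {1..n} (\<lambda>a b c d. of_bool (separated H a b c d))"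
  let ?good = "\<lambda>H. \<exists>C\<in>graph_components n H. real (card (edges_inside H C)) \<ge> (1 - \<delta>) * real (card H)"
  let ?few = "\<lambda>G H. of_bool (2 * real (card H) < p * real (card G)) :: real"
  define c where "c = 4 / (\<delta> * (p * M)\<^sup>2)"
  have c: "0 < c" using dpos p M by (simp add: c_def)
  \<comment> \<open>Outside the good event, \<open>H\<close> has few edges or the scaled number \<open>c * ?Q H\<close> is at least \<open>1\<close>.\<close>
  have "1 = joint_mean n D p (\<lambda>G H. 1)" using joint_mean_one[OF R] by simp
  also have "\<dots> \<le> joint_mean n D p (\<lambda>G H. of_bool (?good H) + ?few G H + c * ?Q H)"
  proof (rule joint_mean_mono)
    fix G H assume G: "G \<in> realizations n D" and H: "H \<subseteq> G"
    have "simple_graph n H" using G H by (auto simp: realizations_def simple_graph_def)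
    have Q0: "0 \<le> ?Q H" unfolding quad_sum_def by (intro sum_nonneg) auto
    have GM: "2 * real (card G) = M" using sum_degrees[OF G] by (simp add: M_def degree_sum_def)
    show "1 \<le> of_bool (?good H) + ?few G H + c * ?Q H"
    proof (cases "2 * real (card H) < p * real (card G) \<or> 1 \<le> c * ?Q H")
      case True
      then show ?thesis using Q0 c by auto
    next
      case False
      then have cQ: "c * ?Q H \<le> 1" and "p * M / 2 \<le> 2 * real (card H)" using GM by auto
      then have "(p * M / 2)\<^sup>2 \<le> (2 * real (card H))\<^sup>2" using p M by (intro power_mono) auto
      then have "\<delta> * (p * M / 2)\<^sup>2 \<le> \<delta> * (2 * real (card H))\<^sup>2" using dpos by (intro mult_left_mono) auto
      moreover have "?Q H \<le> \<delta> * (p * M / 2)\<^sup>2"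
        using cQ dpos p M unfolding c_def by (simp add: field_simps power2_eq_square)
      ultimately have "?good H"
        by (intro giant_component_if_few_separated[OF \<open>simple_graph n H\<close> n]) linarith
      then show ?thesis using Q0 c by auto
    qed
  qed (use p in auto)
  also have "\<dots> = joint_mean n D p (\<lambda>G H. of_bool (?good H)) + joint_mean n D p ?few + c * joint_mean n D p (\<lambda>G H. ?Q H)"
    by (simp only: joint_mean_add joint_mean_cmult)
  also have "joint_mean n D p (\<lambda>G H. of_bool (?good H)) = measure_pmf.prob (percolated_random_graph n D p) {H. ?good H}"
    using R p by (subst prob_percolated_random_graph) auto
  also have "joint_mean n D p ?few \<le> 8 / (p * d)"
  proof (rule joint_mean_bound)
    fix G assume G: "G \<in> realizations n D"
    have GM: "real (card G) = M / 2" using sum_degrees[OF G] by (simp add: M_def degree_sum_def)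
    have "perc_mean p G (?few G) \<le> 4 / (p * real (card G))"
      using p M GM by (intro few_kept_edges_le realizations_finite[OF G]) auto
    also have "\<dots> = 8 / (p * M)" by (simp add: GM)
    also have "\<dots> \<le> 8 / (p * d)" using p d dM by (intro divide_left_mono mult_left_mono) auto
    finally show "perc_mean p G (?few G) \<le> 8 / (p * d)" .
  qed (use p d in auto)
  also have "c * joint_mean n D p (\<lambda>G H. ?Q H) \<le> \<delta>"
  proof -
    have "c * joint_mean n D p (\<lambda>G H. ?Q H) \<le> c * (16 * p * card S * M + 4 * p\<^sup>2 * W * M)"
      using separated_mean_le[of p S n D] p S c
      by (intro mult_left_mono) (auto simp: M_def W_def degree_sum_def)
    also have "\<dots> = (64 * (card S / (p * M)) + 16 * W / M) / \<delta>"
      using p M dpos by (simp add: c_def field_simps power2_eq_square)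
    also have "\<dots> \<le> \<delta>\<^sup>2 / \<delta>"
    proof (rule divide_right_mono)
      have "card S / (p * M) \<le> 1 / (p * d)"
        using sM p d M by (simp add: field_simps)
      then show "64 * (card S / (p * M)) + 16 * W / M \<le> \<delta>\<^sup>2" by (simp add: dsq)
    qed (use dpos in simp)
    also have "\<dots> = \<delta>" using dpos by (simp add: power2_eq_square)
    finally show ?thesis .
  qed
  finally show ?thesis by simp
qed

section \<open>Non-isolated vertices\<close>

lemma connected_in_touched:
  assumes "connected_in H x y" "x \<noteq> y"
  shows "\<exists>e\<in>H. x \<in> e"
  using assms(1)[unfolded connected_in_def] assms(2)
  by (cases rule: converse_rtranclE) auto

lemma L1_le_touched:
  assumes S: "S \<subseteq> {1..n}" "S \<noteq> {}"
  shows "L1 n H \<le> card S + card {v \<in> {1..n} - S. \<exists>e\<in>H. v \<in> e}" (is "_ \<le> card S + card ?N")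
proof -
  have fS: "finite S" using S finite_subset by blast
  have s1: "1 \<le> card S" using S(2) fS by (simp add: Suc_leI card_gt_0_iff)
  have "card (component_of n H v) \<le> card S + card ?N" if "v \<in> {1..n}" for v
  proof (cases "component_of n H v \<subseteq> {v}")
    case True
    then have "card (component_of n H v) \<le> card {v}" by (intro card_mono) auto
    then show ?thesis using s1 by simp
  next
    case False
    then obtain u where u: "connected_in H v u" "u \<noteq> v" by (auto simp: component_of_eq)
    have "component_of n H v \<subseteq> S \<union> ?N"
    proof
      fix w assume w: "w \<in> component_of n H v"
      then have vw: "connected_in H v w" by (simp add: component_of_eq)
      have "\<exists>e\<in>H. w \<in> e"
      proof (cases "w = v")
        case True
        then show ?thesis using connected_in_touched[OF u(1)] u(2) by auto
      next
        case False
        have "connected_in H w v" using vw connected_in_sym[of H v w] by simp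
        then show ?thesis using connected_in_touched[of H w v] False by blast
      qed
      then show "w \<in> S \<union> ?N" using w by (auto simp: component_of_eq)
    qed
    then have "card (component_of n H v) \<le> card (S \<union> ?N)"
      using fS by (intro card_mono) auto
    also have "\<dots> \<le> card S + card ?N" by (rule card_Un_le)
    finally show ?thesis .
  qed
  then show ?thesis
    using S unfolding L1_def graph_components_def by (intro Max.boundedI) auto
qed

text \<open>For \<open>k\<close> independent edges, the left side is the probability that exactly one is kept, the right side
  the probability that at least one is kept.\<close>

lemma degree_decay:
  assumes "0 \<le> p" "p \<le> (1::real)"
  shows "real k * (p * (1 - p) ^ (k - 1)) \<le> 1 - (1 - p) ^ k"
proof -
  have "1 - (1 - p) ^ k = p * (\<Sum>i<k. (1 - p) ^ i)"
    using one_diff_power_eq[of "1 - p" k] by simp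
  also have "\<dots> \<ge> p * (\<Sum>i<k. (1 - p) ^ (k - 1))"
    using assms by (intro mult_left_mono sum_mono power_decreasing) auto
  finally show ?thesis by (simp add: mult.left_commute)
qed

lemma card_incident_union:
  assumes "simple_graph n G" "u \<noteq> v"
  shows "card ({e \<in> G. u \<in> e} \<union> {e \<in> G. v \<in> e}) + of_bool ({u, v} \<in> G) = vertex_degree G u + vertex_degree G v"
proof -
  have "{e \<in> G. u \<in> e} \<inter> {e \<in> G. v \<in> e} = (if {u, v} \<in> G then {{u, v}} else {})"
  proof -
    have "e = {u, v}" if e: "e \<in> G" "u \<in> e" "v \<in> e" for e
    proof -
      have "card e = 2" using assms(1) e(1) by (simp add: simple_graph_def)
      then obtain x y where "e = {x, y}" by (auto simp: card_2_iff)
      then show ?thesis using e assms(2) by auto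
    qed
    then have "{e \<in> G. u \<in> e} \<inter> {e \<in> G. v \<in> e} \<subseteq> {{u, v}} \<inter> G" by blast
    moreover have "{{u, v}} \<inter> G \<subseteq> {e \<in> G. u \<in> e} \<inter> {e \<in> G. v \<in> e}" by auto
    ultimately show ?thesis by (cases "{u, v} \<in> G") auto
  qed
  then show ?thesis
    using card_Un_Int[of "{e \<in> G. u \<in> e}" "{e \<in> G. v \<in> e}"] simple_graph_finite[OF assms(1)]
    by (auto simp: vertex_degree_def)
qed

text \<open>Whether \<open>u\<close> and \<open>v\<close> are isolated depends on the edges at \<open>u\<close> and the edges at \<open>v\<close>, and for
  \<open>u \<noteq> v\<close> these sets share at most the edge \<open>{u, v}\<close>. So only adjacent pairs are correlated, with
  covariance at most \<open>p (1 - p) ^ (D u - 1)\<close>. Summing over the at most \<open>D u\<close> neighbours and applying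
  \<open>degree_decay\<close> bounds the total covariance at \<open>u\<close> by the mean at \<open>u\<close>; the diagonal contributes
  the same amount once more.\<close>

lemma touched_variance_le:
  assumes G: "G \<in> realizations n D" and p: "0 \<le> p" "p \<le> 1" and W: "W \<subseteq> {1..n}"
  defines "\<mu> \<equiv> (\<Sum>v\<in>W. 1 - (1 - p) ^ D v)"
  shows "perc_mean p G (\<lambda>H. (real (card {v \<in> W. \<exists>e\<in>H. v \<in> e}) - \<mu>)\<^sup>2) \<le> 2 * \<mu>"
proof -
  have sg: "simple_graph n G" and deg: "\<And>v. v \<in> W \<Longrightarrow> vertex_degree G v = D v"
    using G W by (auto simp: realizations_def)
  have fin: "finite G" by (rule simple_graph_finite[OF sg])
  have fW: "finite W" using W finite_subset by blast
  define star where "star v = {e \<in> G. v \<in> e}" for v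
  define a where "a A = perc_mean p G (\<lambda>H. of_bool (H \<inter> A = {}))" for A
  define X :: "nat \<Rightarrow> nat set set \<Rightarrow> real" where "X v H = 1 - of_bool (H \<inter> star v = {})" for v H
  have a: "a A = (1 - p) ^ card A" if "A \<subseteq> G" for A
    unfolding a_def by (rule perc_mean_avoid[OF fin that])
  have star: "star v \<subseteq> G" for v by (auto simp: star_def)
  have cstar: "card (star v) = D v" if "v \<in> W" for v
    using deg[OF that] by (simp add: star_def vertex_degree_def)
  have EX: "perc_mean p G (X v) = 1 - a (star v)" for v
    unfolding X_def perc_mean_minus a_def by (simp add: perc_mean_const fin)
  have EXX: "perc_mean p G (\<lambda>H. X u H * X v H) = 1 - a (star u) - a (star v) + a (star u \<union> star v)" for u v
  proof -
    have "perc_mean p G (\<lambda>H. X u H * X v H) = perc_mean p G (\<lambda>H. 1 - of_bool (H \<inter> star u = {})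
       - of_bool (H \<inter> star v = {}) + of_bool (H \<inter> (star u \<union> star v) = {}))"
      by (rule perc_mean_cong) (auto simp: X_def)
    then show ?thesis
      unfolding perc_mean_minus perc_mean_add a_def by (simp add: perc_mean_const fin)
  qed
  have cov: "perc_mean p G (\<lambda>H. X u H * X v H) - perc_mean p G (X u) * perc_mean p G (X v)
      \<le> of_bool (u = v) * (1 - (1 - p) ^ D u) + of_bool ({u, v} \<in> G) * (p * (1 - p) ^ (D u - 1))"
    if uv: "u \<in> W" "v \<in> W" for u v
  proof -
    have eq: "perc_mean p G (\<lambda>H. X u H * X v H) - perc_mean p G (X u) * perc_mean p G (X v)
      = a (star u \<union> star v) - (1 - p) ^ D u * (1 - p) ^ D v"
      using uv by (simp add: EX EXX a star cstar algebra_simps)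
    show ?thesis
    proof (cases "u = v")
      case True
      have "(1 - p) ^ D u - (1 - p) ^ D u * (1 - p) ^ D u = (1 - p) ^ D u * (1 - (1 - p) ^ D u)"
        by (simp add: algebra_simps)
      also have "\<dots> \<le> 1 * (1 - (1 - p) ^ D u)"
        using p by (intro mult_right_mono) (auto simp: power_le_one)
      finally have le: "(1 - p) ^ D u - (1 - p) ^ D u * (1 - p) ^ D u \<le> 1 - (1 - p) ^ D u" by simp
      have "{u, v} \<notin> G" using True simple_graph_edge[OF sg, of u u] by auto
      then show ?thesis unfolding eq using True le uv by (simp add: a star cstar)
    next
      case False
      have card: "card (star u \<union> star v) + of_bool ({u, v} \<in> G) = D u + D v"
        using card_incident_union[OF sg False] deg uv by (simp add: star_def)
      have a2: "a (star u \<union> star v) = (1 - p) ^ card (star u \<union> star v)"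
        using star by (intro a) auto
      show ?thesis
      proof (cases "{u, v} \<in> G")
        case True
        define k where "k = card (star u \<union> star v)"
        have k: "D u + D v = Suc k" using card True by (simp add: k_def)
        have "star v \<noteq> {}" using True by (auto simp: star_def)
        then have "0 < card (star v)" using finite_subset[OF star fin] by (simp add: card_gt_0_iff)
        then have "1 \<le> D v" using cstar[OF uv(2)] by simp
        then have "D u - 1 \<le> k" using k by simp
        then have "p * (1 - p) ^ k \<le> p * (1 - p) ^ (D u - 1)"
          using p by (intro mult_left_mono power_decreasing) auto
        moreover have "(1 - p) ^ k - (1 - p) ^ D u * (1 - p) ^ D v = p * (1 - p) ^ k"
          by (simp add: power_add[symmetric] k algebra_simps)
        ultimately show ?thesis unfolding eq a2 using True False by (simp add: k_def)
      next
        case notin: False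
        then have "card (star u \<union> star v) = D u + D v" using card by simp
        then show ?thesis unfolding eq a2 using notin False by (simp add: power_add)
      qed
    qed
  qed
  have "perc_mean p G (\<lambda>H. (real (card {v \<in> W. \<exists>e\<in>H. v \<in> e}) - \<mu>)\<^sup>2)
    = perc_mean p G (\<lambda>H. ((\<Sum>v\<in>W. X v H) - (\<Sum>v\<in>W. perc_mean p G (X v)))\<^sup>2)"
  proof (rule perc_mean_cong)
    fix H assume H: "H \<subseteq> G"
    have "(\<Sum>v\<in>W. X v H) = (\<Sum>v\<in>W. of_bool (\<exists>e\<in>H. v \<in> e))"
      using H by (intro sum.cong refl) (auto simp: X_def star_def)
    also have "\<dots> = card {v \<in> W. \<exists>e\<in>H. v \<in> e}" using fW by (simp add: sum_of_bool_eq Int_def)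
    finally have "real (card {v \<in> W. \<exists>e\<in>H. v \<in> e}) = (\<Sum>v\<in>W. X v H)" by simp
    moreover have "\<mu> = (\<Sum>v\<in>W. perc_mean p G (X v))"
      unfolding \<mu>_def by (intro sum.cong refl) (simp add: EX a star cstar)
    ultimately show "(real (card {v \<in> W. \<exists>e\<in>H. v \<in> e}) - \<mu>)\<^sup>2
      = ((\<Sum>v\<in>W. X v H) - (\<Sum>v\<in>W. perc_mean p G (X v)))\<^sup>2" by simp
  qed
  also have "\<dots> = (\<Sum>u\<in>W. \<Sum>v\<in>W. perc_mean p G (\<lambda>H. X u H * X v H)
      - perc_mean p G (X u) * perc_mean p G (X v))"
    by (rule perc_mean_square_deviation[OF fin])
  also have "\<dots> \<le> (\<Sum>u\<in>W. \<Sum>v\<in>W. of_bool (u = v) * (1 - (1 - p) ^ D u)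
      + of_bool ({u, v} \<in> G) * (p * (1 - p) ^ (D u - 1)))"
    by (intro sum_mono cov)
  also have "\<dots> = (\<Sum>u\<in>W. (1 - (1 - p) ^ D u) + (\<Sum>v\<in>W. of_bool ({u, v} \<in> G)) * (p * (1 - p) ^ (D u - 1)))"
  proof (intro sum.cong refl)
    fix u assume "u \<in> W"
    then have "(\<Sum>v\<in>W. of_bool (u = v) :: real) = 1" using fW by (simp add: of_bool_def)
    then show "(\<Sum>v\<in>W. of_bool (u = v) * (1 - (1 - p) ^ D u) + of_bool ({u, v} \<in> G) * (p * (1 - p) ^ (D u - 1)))
      = (1 - (1 - p) ^ D u) + (\<Sum>v\<in>W. of_bool ({u, v} \<in> G)) * (p * (1 - p) ^ (D u - 1))"
      by (simp only: sum.distrib sum_distrib_right[symmetric] mult_1)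
  qed
  also have "\<dots> \<le> (\<Sum>u\<in>W. (1 - (1 - p) ^ D u) + (1 - (1 - p) ^ D u))"
  proof (intro sum_mono add_left_mono)
    fix u assume u: "u \<in> W"
    have "(\<Sum>v\<in>W. of_bool ({u, v} \<in> G) :: real) \<le> (\<Sum>v\<in>{1..n}. of_bool ({u, v} \<in> G))"
      using W by (intro sum_mono2) auto
    also have "\<dots> = D u" using sum_neighbours[OF G] u W by blast
    finally have "(\<Sum>v\<in>W. of_bool ({u, v} \<in> G)) * (p * (1 - p) ^ (D u - 1)) \<le> real (D u) * (p * (1 - p) ^ (D u - 1))"
      using p by (intro mult_right_mono) auto
    also have "\<dots> \<le> 1 - (1 - p) ^ D u" by (rule degree_decay[OF p])
    finally show "(\<Sum>v\<in>W. of_bool ({u, v} \<in> G)) * (p * (1 - p) ^ (D u - 1)) \<le> 1 - (1 - p) ^ D u" .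
  qed
  also have "\<dots> = 2 * \<mu>" by (simp add: \<mu>_def sum_distrib_left)
  finally show ?thesis .
qed

text \<open>Chebyshev's inequality at distance \<open>\<epsilon> (|S| + \<mu>)\<close>, using \<open>\<mu> |S| \<le> (|S| + \<mu>)\<^sup>2\<close>.\<close>

lemma largest_component_prob:
  fixes p \<epsilon> :: real and D :: "nat \<Rightarrow> nat"
  assumes R: "realizations n D \<noteq> {}" and p: "0 \<le> p" "p \<le> 1" and \<epsilon>: "0 < \<epsilon>"
    and S: "S \<subseteq> {1..n}" "S \<noteq> {}"
  shows "1 - 2 / (\<epsilon>\<^sup>2 * real (card S)) \<le> measure_pmf.prob (percolated_random_graph n D p)
    {H. real (L1 n H) \<le> (1 + \<epsilon>) * (real (card S) + (\<Sum>v\<in>{1..n} - S. 1 - (1 - p) ^ D v))}"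
proof -
  define W where "W = {1..n} - S"
  define \<mu> where "\<mu> = (\<Sum>v\<in>W. 1 - (1 - p) ^ D v)"
  define s where "s = real (card S)"
  have "finite S" using S finite_subset by blast
  then have s: "0 < s" using S(2) by (simp add: s_def card_gt_0_iff)
  have \<mu>: "0 \<le> \<mu>" unfolding \<mu>_def using p by (intro sum_nonneg) (auto simp: power_le_one)
  let ?good = "\<lambda>H. real (L1 n H) \<le> (1 + \<epsilon>) * (s + \<mu>)"
  let ?N = "\<lambda>H. real (card {v \<in> W. \<exists>e\<in>H. v \<in> e})"
  define c where "c = 1 / (\<epsilon> * (s + \<mu>))\<^sup>2"
  have c: "0 < c" using \<epsilon> s \<mu> by (simp add: c_def)
  have "1 = joint_mean n D p (\<lambda>G H. 1)" using joint_mean_one[OF R] by simp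
  also have "\<dots> \<le> joint_mean n D p (\<lambda>G H. of_bool (?good H) + c * (?N H - \<mu>)\<^sup>2)"
  proof (rule joint_mean_mono[OF p])
    fix G H :: "nat set set"
    show "1 \<le> of_bool (?good H) + c * (?N H - \<mu>)\<^sup>2"
    proof (cases "?good H")
      case True
      then show ?thesis using c by simp
    next
      case False
      have "real (L1 n H) \<le> s + ?N H"
        using L1_le_touched[OF S, of H] by (simp add: s_def W_def)
      then have "\<epsilon> * (s + \<mu>) \<le> ?N H - \<mu>" using False by (simp add: algebra_simps)
      then have "(\<epsilon> * (s + \<mu>))\<^sup>2 \<le> (?N H - \<mu>)\<^sup>2" using \<epsilon> s \<mu> by (intro power_mono) auto
      then have "1 \<le> c * (?N H - \<mu>)\<^sup>2" using \<epsilon> s \<mu> by (simp add: c_def)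
      then show ?thesis by simp
    qed
  qed
  also have "\<dots> = joint_mean n D p (\<lambda>G H. of_bool (?good H)) + c * joint_mean n D p (\<lambda>G H. (?N H - \<mu>)\<^sup>2)"
    by (simp only: joint_mean_add joint_mean_cmult)
  also have "joint_mean n D p (\<lambda>G H. of_bool (?good H)) = measure_pmf.prob (percolated_random_graph n D p) {H. ?good H}"
    using prob_percolated_random_graph[OF R p, of ?good] by simp
  also have "joint_mean n D p (\<lambda>G H. (?N H - \<mu>)\<^sup>2) \<le> 2 * \<mu>"
    using \<mu> p unfolding \<mu>_def by (intro joint_mean_bound touched_variance_le) (auto simp: W_def)
  also have "c * (2 * \<mu>) \<le> 2 / (\<epsilon>\<^sup>2 * s)"
  proof -
    define t where "t = (s + \<mu>)\<^sup>2"
    have "0 < s + \<mu>" using s \<mu> by linarith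
    then have t: "0 < t" "\<mu> * s \<le> t" using s \<mu>
      by (simp_all add: t_def) (simp add: power2_eq_square algebra_simps)
    have "c * (2 * \<mu>) = (2 / \<epsilon>\<^sup>2) * (\<mu> / t)" by (simp add: c_def t_def power_mult_distrib)
    also have "\<dots> \<le> (2 / \<epsilon>\<^sup>2) * (1 / s)"
      using t s by (intro mult_left_mono) (simp_all add: field_simps)
    finally show ?thesis by simp
  qed
  finally show ?thesis using c by (simp add: s_def \<mu>_def W_def)
qed

section \<open>The asymptotic statement\<close>

lemma tendsto_0_if_eventually_le_any:
  fixes f :: "nat \<Rightarrow> real"
  assumes "\<And>\<epsilon>. 0 < \<epsilon> \<Longrightarrow> \<forall>\<^sub>F n in sequentially. 0 \<le> f n \<and> f n \<le> \<epsilon>"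
  shows "f \<longlonglongrightarrow> 0"
proof (rule tendstoI)
  fix \<epsilon> :: real assume "0 < \<epsilon>"
  then have "\<forall>\<^sub>F n in sequentially. 0 \<le> f n \<and> f n \<le> \<epsilon> / 2" by (intro assms) simp
  then show "\<forall>\<^sub>F n in sequentially. dist (f n) 0 < \<epsilon>"
    by eventually_elim (use \<open>0 < \<epsilon>\<close> in auto)
qed

lemma prob_tendsto_1:
  assumes "\<forall>\<^sub>F n in sequentially. 1 - f n \<le> measure_pmf.prob (M n) (A n)" "f \<longlonglongrightarrow> 0"
  shows "(\<lambda>n. measure_pmf.prob (M n) (A n)) \<longlonglongrightarrow> 1"
proof (rule tendsto_sandwich[OF assms(1)])
  show "(\<lambda>n. 1 - f n) \<longlonglongrightarrow> 1" using tendsto_diff[OF tendsto_const assms(2), of 1] by simp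
qed (auto simp: measure_pmf.prob_le_1)

theorem theorem1p9:
  fixes D :: "nat \<Rightarrow> nat \<Rightarrow> nat" and d :: "nat \<Rightarrow> real"
  assumes feasible: "\<And>n. 2 \<le> n \<Longrightarrow> feasible n (D n)"
  shows
    "(filterlim (\<lambda>n. card (high_degree n (D n) (d n))) at_top sequentially \<longrightarrow>
       (\<forall>p :: nat \<Rightarrow> real. (\<forall>n. 0 \<le> p n \<and> p n \<le> 1) \<longrightarrow>
         (\<exists>\<epsilon> :: nat \<Rightarrow> real. \<epsilon> \<longlonglongrightarrow> 0 \<and>
           (\<lambda>n. measure_pmf.prob (percolated_random_graph n (D n) (p n))
              {H. real (L1 n H) \<le> (1 + \<epsilon> n) *
                 (real (card (high_degree n (D n) (d n)))
                  + (\<Sum>v\<in>{1..n} - high_degree n (D n) (d n). 1 - (1 - p n) ^ D n v))})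
           \<longlonglongrightarrow> 1)))
     \<and>
     ((\<forall>\<^sub>F n in sequentially. 0 < d n) \<longrightarrow>
      (\<lambda>n. real (degree_sum (D n) (high_degree n (D n) (d n))))
        \<ggreater> (\<lambda>n. real (degree_sum (D n) ({1..n} - high_degree n (D n) (d n)))) \<longrightarrow>
       (\<forall>p :: nat \<Rightarrow> real. (\<forall>n. 0 \<le> p n \<and> p n \<le> 1) \<longrightarrow> p \<ggreater> (\<lambda>n. 1 / d n) \<longrightarrow>
         (\<exists>\<epsilon> :: nat \<Rightarrow> real. \<epsilon> \<longlonglongrightarrow> 0 \<and>
           (\<lambda>n. measure_pmf.prob (percolated_random_graph n (D n) (p n))
              {H. \<exists>C\<in>graph_components n H.
                 real (card (edges_inside H C)) \<ge> (1 - \<epsilon> n) * real (card H)})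
           \<longlonglongrightarrow> 1)))"
proof -
  define S where "S n = high_degree n (D n) (d n)" for n
  have S: "S n \<subseteq> {1..n}" "finite (S n)" for n
    by (auto simp: S_def high_degree_def)
  have R: "\<forall>\<^sub>F n in sequentially. realizations n (D n) \<noteq> {}"
    using eventually_ge_at_top[of 2] by eventually_elim (use feasible in \<open>auto simp: feasible_def\<close>)
  have part_a: "\<exists>\<epsilon> :: nat \<Rightarrow> real. \<epsilon> \<longlonglongrightarrow> 0 \<and>
      (\<lambda>n. measure_pmf.prob (percolated_random_graph n (D n) (p n))
        {H. real (L1 n H) \<le> (1 + \<epsilon> n) * (real (card (S n)) + (\<Sum>v\<in>{1..n} - S n. 1 - (1 - p n) ^ D n v))}) \<longlonglongrightarrow> 1"
    if inf: "filterlim (\<lambda>n. card (S n)) at_top sequentially" and p: "\<And>n. 0 \<le> p n \<and> p n \<le> 1" for p :: "nat \<Rightarrow> real"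
  proof -
    \<comment> \<open>The failure probability \<open>2 / (\<epsilon>\<^sup>2 |S|)\<close> is then \<open>2 / sqrt |S|\<close>, which still tends to \<open>0\<close>.\<close>
    define \<epsilon> where "\<epsilon> n = 1 / sqrt (sqrt (real (card (S n))))" for n
    have lim: "filterlim (\<lambda>n. sqrt (real (card (S n)))) at_top sequentially"
      using inf by (intro filterlim_compose[OF sqrt_at_top] filterlim_compose[OF filterlim_real_sequentially])
    have "\<epsilon> \<longlonglongrightarrow> 0"
      unfolding \<epsilon>_def by (intro real_tendsto_divide_at_top[OF tendsto_const] filterlim_compose[OF sqrt_at_top] lim)
    moreover have "(\<lambda>n. measure_pmf.prob (percolated_random_graph n (D n) (p n))
        {H. real (L1 n H) \<le> (1 + \<epsilon> n) * (real (card (S n)) + (\<Sum>v\<in>{1..n} - S n. 1 - (1 - p n) ^ D n v))}) \<longlonglongrightarrow> 1"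
    proof (rule prob_tendsto_1)
      show "(\<lambda>n. 2 / sqrt (real (card (S n)))) \<longlonglongrightarrow> 0"
        by (intro real_tendsto_divide_at_top[OF tendsto_const] lim)
      have "\<forall>\<^sub>F n in sequentially. 1 \<le> card (S n)" using inf by (simp add: filterlim_at_top)
      with R show "\<forall>\<^sub>F n in sequentially. 1 - 2 / sqrt (real (card (S n))) \<le>
        measure_pmf.prob (percolated_random_graph n (D n) (p n))
        {H. real (L1 n H) \<le> (1 + \<epsilon> n) * (real (card (S n)) + (\<Sum>v\<in>{1..n} - S n. 1 - (1 - p n) ^ D n v))}"
      proof eventually_elim
        case (elim n)
        define s where "s = real (card (S n))"
        have s: "0 < s" "0 < \<epsilon> n" "S n \<noteq> {}" using elim by (auto simp: s_def \<epsilon>_def)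
        have "(\<epsilon> n)\<^sup>2 * s = sqrt s"
          using s(1) by (simp add: \<epsilon>_def s_def[symmetric] power_divide real_div_sqrt)
        then show ?case
          using largest_component_prob[OF elim(1) _ _ s(2) S(1) s(3), of "p n"] p by (simp add: s_def)
      qed
    qed
    ultimately show ?thesis by blast
  qed
  have part_b: "\<exists>\<epsilon> :: nat \<Rightarrow> real. \<epsilon> \<longlonglongrightarrow> 0 \<and>
      (\<lambda>n. measure_pmf.prob (percolated_random_graph n (D n) (p n))
        {H. \<exists>C\<in>graph_components n H. real (card (edges_inside H C)) \<ge> (1 - \<epsilon> n) * real (card H)}) \<longlonglongrightarrow> 1"
    if d: "\<forall>\<^sub>F n in sequentially. 0 < d n" and p: "\<And>n. 0 \<le> p n \<and> p n \<le> 1"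
      and heavy: "(\<lambda>n. real (degree_sum (D n) (S n))) \<ggreater> (\<lambda>n. real (degree_sum (D n) ({1..n} - S n)))"
      and large: "p \<ggreater> (\<lambda>n. 1 / d n)" for p :: "nat \<Rightarrow> real"
  proof -
    define f where "f n = 1 / (p n * d n)" for n
    define g where "g n = real (degree_sum (D n) ({1..n} - S n)) / real (degree_sum (D n) {1..n})" for n
    define \<epsilon> where "\<epsilon> n = sqrt (64 / (p n * d n)
      + 16 * real (degree_sum (D n) ({1..n} - S n)) / real (degree_sum (D n) {1..n}))" for n
    have bound: "\<forall>\<^sub>F n in sequentially. 0 < p n \<and> f n \<le> \<gamma>" if "0 < \<gamma>" for \<gamma>
    proof -
      have "\<forall>\<^sub>F n in sequentially. 1 / d n \<le> \<gamma> * p n"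
        using large that by (simp add: much_greater_def)
      with d show ?thesis
      proof eventually_elim
        case (elim n)
        then have "0 < \<gamma> * p n" by (smt (verit) divide_pos_pos)
        then have "0 < p n" using that by (simp add: zero_less_mult_iff)
        then show ?case using elim by (simp add: f_def field_simps)
      qed
    qed
    have f: "f \<longlonglongrightarrow> 0"
    proof (rule tendsto_0_if_eventually_le_any)
      fix \<gamma> :: real assume "0 < \<gamma>"
      from bound[OF this] d show "\<forall>\<^sub>F n in sequentially. 0 \<le> f n \<and> f n \<le> \<gamma>"
        by eventually_elim (simp add: f_def)
    qed
    have split: "degree_sum (D n) {1..n} = degree_sum (D n) (S n) + degree_sum (D n) ({1..n} - S n)" for n
      unfolding degree_sum_def using S(1)[of n] by (simp add: sum.subset_diff add.commute)
    have g: "g \<longlonglongrightarrow> 0"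
    proof (rule tendsto_0_if_eventually_le_any)
      fix \<gamma> :: real assume \<gamma>: "0 < \<gamma>"
      then have "\<forall>\<^sub>F n in sequentially.
          real (degree_sum (D n) ({1..n} - S n)) \<le> \<gamma> * real (degree_sum (D n) (S n))"
        using heavy by (simp add: much_greater_def)
      then show "\<forall>\<^sub>F n in sequentially. 0 \<le> g n \<and> g n \<le> \<gamma>"
      proof eventually_elim
        case (elim n)
        also have "\<gamma> * real (degree_sum (D n) (S n)) \<le> \<gamma> * real (degree_sum (D n) {1..n})"
          using \<gamma> split[of n] by (intro mult_left_mono) auto
        finally show ?case
          using \<gamma> by (cases "degree_sum (D n) {1..n} = 0") (auto simp: g_def field_simps)
      qed
    qed
    have "(\<lambda>n. sqrt (64 * f n + 16 * g n)) \<longlonglongrightarrow> sqrt (64 * 0 + 16 * 0)"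
      by (intro tendsto_intros f g)
    moreover have "\<epsilon> = (\<lambda>n. sqrt (64 * f n + 16 * g n))"
      by (simp add: \<epsilon>_def f_def g_def fun_eq_iff)
    ultimately have \<epsilon>: "\<epsilon> \<longlonglongrightarrow> 0" by simp
    \<comment> \<open>An empty \<open>S n\<close> would have degree sum \<open>0\<close>, whereas all degrees are positive.\<close>
    have nonempty: "\<forall>\<^sub>F n in sequentially. S n \<noteq> {}"
    proof -
      have "\<forall>\<^sub>F n in sequentially.
          real (degree_sum (D n) ({1..n} - S n)) \<le> 1 * real (degree_sum (D n) (S n))"
        using heavy unfolding much_greater_def by (elim allE[of _ 1]) simp
      then show ?thesis using eventually_ge_at_top[of 2]
      proof eventually_elim
        case (elim n)
        have "\<forall>v\<in>{1..n}. 1 \<le> D n v" using feasible[OF elim(2)] by (simp add: feasible_def)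
        then have "1 \<le> D n 1" using elim(2) by auto
        also have "D n 1 \<le> degree_sum (D n) {1..n}"
          unfolding degree_sum_def using elim(2) by (intro member_le_sum) auto
        finally have "1 \<le> degree_sum (D n) {1..n}" .
        moreover have "degree_sum (D n) {} = 0" by (simp add: degree_sum_def)
        ultimately show ?case using elim(1) by (cases "S n = {}") simp_all
      qed
    qed
    have "(\<lambda>n. measure_pmf.prob (percolated_random_graph n (D n) (p n))
        {H. \<exists>C\<in>graph_components n H. real (card (edges_inside H C)) \<ge> (1 - \<epsilon> n) * real (card H)}) \<longlonglongrightarrow> 1"
    proof (rule prob_tendsto_1)
      have "(\<lambda>n. 8 * f n + \<epsilon> n) \<longlonglongrightarrow> 8 * 0 + 0"
        by (intro tendsto_intros f \<epsilon>)
      then show "(\<lambda>n. 8 / (p n * d n) + \<epsilon> n) \<longlonglongrightarrow> 0" by (simp add: f_def)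
      show "\<forall>\<^sub>F n in sequentially. 1 - (8 / (p n * d n) + \<epsilon> n) \<le>
          measure_pmf.prob (percolated_random_graph n (D n) (p n))
          {H. \<exists>C\<in>graph_components n H. real (card (edges_inside H C)) \<ge> (1 - \<epsilon> n) * real (card H)}"
        using R d nonempty bound[of 1, OF zero_less_one]
      proof eventually_elim
        case (elim n)
        show ?case
          unfolding \<epsilon>_def
          by (rule giant_component_prob) (use elim p S in \<open>auto simp: S_def high_degree_def\<close>)
      qed
    qed
    with \<epsilon> show ?thesis by blast
  qed
  show ?thesis
    using part_a part_b unfolding S_def by blast
qed

end
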